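(* If $G\in\mathcal{G}^*$, then $\chi'_l(G)=\chi'(G)$.
   Context: All graphs are simple. $\mathcal{G}^*$ denotes the class of graphs $G$ such that any two distinct odd cycles $C_1,C_2$ of $G$ satisfy $|E(C_1)\cap E(C_2)|\le 1$. $\chi'(G)$ is the chromatic index of $G$. $\chi'_l(G)$ is the list chromatic index of $G$: the least $k$ such that for every assignment of lists of size at least $k$ to the edges of $G$ there is a proper edge-coloring choosing each edge's color from its list. *)

theory Defs
  imports Main
begin

definition simple_graph :: "'a set \<Rightarrow> 'a set set \<Rightarrow> bool" where
  "simple_graph V E \<longleftrightarrow> finite V \<and> (\<forall>e\<in>E. e \<subseteq> V \<and> card e = 2)"

definition is_cycle_list :: "'a set set \<Rightarrow> 'a list \<Rightarrow> bool" where
  "is_cycle_list E vs \<longleftrightarrow> length vs \<ge> 3 \<and> distinct vs \<and>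
     (\<forall>i < length vs. {vs ! i, vs ! ((i + 1) mod length vs)} \<in> E)"

definition cycle_edges :: "'a list \<Rightarrow> 'a set set" where
  "cycle_edges vs = {{vs ! i, vs ! ((i + 1) mod length vs)} | i. i < length vs}"

text \<open>The edge sets of odd cycles (subgraphs) of the graph; a cycle is identified with its edge set.\<close>
definition odd_cycles :: "'a set set \<Rightarrow> 'a set set set" where
  "odd_cycles E = {cycle_edges vs | vs. is_cycle_list E vs \<and> odd (length vs)}"

definition in_G_star :: "'a set \<Rightarrow> 'a set set \<Rightarrow> bool" where
  "in_G_star V E \<longleftrightarrow> simple_graph V E \<and>
     (\<forall>C1\<in>odd_cycles E. \<forall>C2\<in>odd_cycles E. C1 \<noteq> C2 \<longrightarrow> card (C1 \<inter> C2) \<le> 1)"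

definition proper_edge_coloring :: "'a set set \<Rightarrow> ('a set \<Rightarrow> 'c) \<Rightarrow> bool" where
  "proper_edge_coloring E f \<longleftrightarrow>
     (\<forall>e1\<in>E. \<forall>e2\<in>E. e1 \<noteq> e2 \<and> e1 \<inter> e2 \<noteq> {} \<longrightarrow> f e1 \<noteq> f e2)"

definition chromatic_index :: "'a set set \<Rightarrow> nat" where
  "chromatic_index E = (LEAST k. \<exists>f :: 'a set \<Rightarrow> nat.
      proper_edge_coloring E f \<and> (\<forall>e\<in>E. f e < k))"

definition list_chromatic_index :: "'a set set \<Rightarrow> nat" where
  "list_chromatic_index E = (LEAST k. \<forall>L :: 'a set \<Rightarrow> nat set.
      (\<forall>e\<in>E. finite (L e) \<and> card (L e) \<ge> k) \<longrightarrow>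
      (\<exists>f. proper_edge_coloring E f \<and> (\<forall>e\<in>E. f e \<in> L e)))"

end

theory Submission
  imports Defs
begin

text \<open>
  Let \<open>k\<close> be the chromatic index. Then all degrees are at most \<open>k\<close>, and \<open>k \<ge> 3\<close> unless the graph is
  bipartite. From these two facts alone we colour from lists of size \<open>k\<close>, by induction on the number
  of edges and for the stronger claim that the edges at one vertex \<open>w\<close>, the root, only need lists of
  size \<open>deg w\<close>. This makes the claim compose along cut vertices: colour one side, then root the other
  side at the cut vertex. An edge with few neighbours can be removed and coloured last.

  A bipartite graph is handled by Galvin's kernel argument, started from a Koenig colouring whose
  colours at \<open>w\<close> are the \<open>deg w\<close> smallest ones.
  In a non-bipartite graph without cut vertices take an odd cycle \<open>C\<close>. Every ear of \<open>C\<close> is even and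
  spans an edge of \<open>C\<close>, and if \<open>C\<close> is not a triangle, all ears span the same edge. So, up to light
  edges, the graph is \<open>K\<^sub>4\<close>, or an edge \<open>uv\<close> together with internally disjoint even paths from \<open>u\<close> to \<open>v\<close>.
  In the second case colour \<open>uv\<close> (or the triangle of \<open>u\<close>, \<open>v\<close> and the root) first; what remains is
  bipartite of smaller maximum degree, up to one exception with five edges.
\<close>

section \<open>Bipartite graphs\<close>

text \<open>The chromatic index may drop in a subgraph, whereas \<open>deg E v \<le> k\<close> and
  the alternative "bipartite or \<open>k \<ge> 3\<close>" are inherited, so \<open>k\<close> stays
  fixed through the induction. The number 3 enters because two colours alternate around a cycle and
  thus exclude odd ones. The size \<open>deg w\<close> at the root is exactly what survives at a cut
  vertex \<open>x\<close>: once one side is coloured, an edge at \<open>x\<close> has lost at most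
  as many colours as that side has edges at \<open>x\<close>, and at least the degree of
  \<open>x\<close> in the other side remains. The price is that edges at the root may have fewer
  than three colours. Hence only edges away from the root are discarded as light, where light means
  degree sum at most 4: at most two neighbouring edges against a list of three. So adjacent vertices
  of degree 2 can survive only at the root. This is why the root occurs in the structure results,
  and the obstacle in the final colourings is to keep the lists at the root long enough.\<close>

definition deg :: "'a set set \<Rightarrow> 'a \<Rightarrow> nat" where
  "deg E v = card {e \<in> E. v \<in> e}"

definition list_colorable :: "'a set set \<Rightarrow> ('a set \<Rightarrow> nat set) \<Rightarrow> bool" where
  "list_colorable E L \<longleftrightarrow> (\<exists>g. proper_edge_coloring E g \<and> (\<forall>e\<in>E. g e \<in> L e))"

definition bipartition :: "('a \<Rightarrow> bool) \<Rightarrow> 'a set set \<Rightarrow> bool" where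
  "bipartition f E \<longleftrightarrow> (\<forall>e\<in>E. \<exists>x y. e = {x, y} \<and> f x \<and> \<not> f y)"

text \<open>Gale-Shapley: \<open>s\<close> ends prefer larger \<open>c\<close>, \<open>t\<close>
  ends smaller \<open>c\<close>. If two edges that are best at their \<open>s\<close> ends meet at
  \<open>t\<close>, the one with larger \<open>c\<close> is deleted; if none meet, the best edges
  form the matching. The deleted \<open>e2\<close> stays dominated by \<open>e1\<close> or, if
  \<open>e1\<close> is not chosen, by what dominates \<open>e1\<close>: being best at its
  \<open>s\<close> end, \<open>e1\<close> can only lose at \<open>t\<close>, to a still smaller
  colour.\<close>

lemma stable_matching_exists:
  fixes s :: "'e \<Rightarrow> 'v" and t :: "'e \<Rightarrow> 'u" and c :: "'e \<Rightarrow> nat"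
  assumes "finite F"
    and "\<forall>e\<in>F. \<forall>e'\<in>F. e \<noteq> e' \<and> (s e = s e' \<or> t e = t e') \<longrightarrow> c e \<noteq> c e'"
  shows "\<exists>K\<subseteq>F. (\<forall>e\<in>K. \<forall>e'\<in>K. e \<noteq> e' \<longrightarrow> s e \<noteq> s e' \<and> t e \<noteq> t e') \<and>
    (\<forall>e\<in>F - K. \<exists>e'\<in>K. (s e' = s e \<and> c e < c e') \<or> (t e' = t e \<and> c e' < c e))"
  using assms
proof (induction F rule: finite_psubset_induct)
  case (psubset F)
  define top where "top e \<longleftrightarrow> e \<in> F \<and> (\<forall>e'\<in>F. s e' = s e \<longrightarrow> c e' \<le> c e)" for e
  show ?case
  proof (cases "\<exists>e1 e2. top e1 \<and> top e2 \<and> t e1 = t e2 \<and> c e1 < c e2")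
    case True
    then obtain e1 e2 where e: "top e1" "top e2" "t e1 = t e2" "c e1 < c e2" by blast
    then have in_F: "e1 \<in> F" "e2 \<in> F" "e1 \<noteq> e2" by (auto simp: top_def)
    have "F - {e2} \<subset> F" using in_F by blast
    moreover have "\<forall>e\<in>F - {e2}. \<forall>e'\<in>F - {e2}. e \<noteq> e' \<and> (s e = s e' \<or> t e = t e') \<longrightarrow> c e \<noteq> c e'"
      using psubset.prems by blast
    ultimately have "\<exists>K\<subseteq>F - {e2}. (\<forall>e\<in>K. \<forall>e'\<in>K. e \<noteq> e' \<longrightarrow> s e \<noteq> s e' \<and> t e \<noteq> t e') \<and>
      (\<forall>e\<in>F - {e2} - K. \<exists>e'\<in>K. (s e' = s e \<and> c e < c e') \<or> (t e' = t e \<and> c e' < c e))"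
      by (rule psubset.IH)
    then obtain K where K: "K \<subseteq> F - {e2}"
      "\<forall>e\<in>K. \<forall>e'\<in>K. e \<noteq> e' \<longrightarrow> s e \<noteq> s e' \<and> t e \<noteq> t e'"
      "\<forall>e\<in>F - {e2} - K. \<exists>e'\<in>K. (s e' = s e \<and> c e < c e') \<or> (t e' = t e \<and> c e' < c e)"
      by (elim exE conjE) (rule that)
    have e2: "\<exists>e'\<in>K. (s e' = s e2 \<and> c e2 < c e') \<or> (t e' = t e2 \<and> c e' < c e2)"
    proof (cases "e1 \<in> K")
      case False
      then obtain e' where e': "e' \<in> K" "(s e' = s e1 \<and> c e1 < c e') \<or> (t e' = t e1 \<and> c e' < c e1)"
        using K(3) in_F by blast
      moreover have "\<not> (s e' = s e1 \<and> c e1 < c e')"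
        using e(1) e'(1) K(1) by (force simp: top_def)
      ultimately show ?thesis using e by (metis less_trans)
    next
      case True
      then show ?thesis using e by metis
    qed
    have "\<forall>e\<in>F - K. \<exists>e'\<in>K. (s e' = s e \<and> c e < c e') \<or> (t e' = t e \<and> c e' < c e)"
    proof
      fix e assume "e \<in> F - K"
      then show "\<exists>e'\<in>K. (s e' = s e \<and> c e < c e') \<or> (t e' = t e \<and> c e' < c e)"
        using K(3) e2 by (cases "e = e2") simp_all
    qed
    moreover have "K \<subseteq> F" using K(1) by blast
    ultimately show ?thesis using K(2) by (intro exI[of _ K] conjI)
  next
    case False
    have indep: "s e \<noteq> s e' \<and> t e \<noteq> t e'" if "top e" "top e'" "e \<noteq> e'" for e e'
    proof -
      have "c e = c e'" if "s e = s e'"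
        using \<open>top e\<close> \<open>top e'\<close> that by (simp add: top_def le_antisym)
      then show ?thesis
        using that False psubset.prems unfolding top_def by (metis linorder_neqE_nat)
    qed
      have dominated: "\<exists>e'. top e' \<and> s e' = s e \<and> c e < c e'" if "e \<in> F" "\<not> top e" for e
    proof -
      let ?A = "{e' \<in> F. s e' = s e}"
      have fin: "finite ?A" "?A \<noteq> {}" using psubset.hyps that by auto
      obtain e' where e': "e' \<in> ?A" "c e' = Max (c ` ?A)"
        using Max_in[of "c ` ?A"] fin by fastforce
      have "c e'' \<le> c e'" if "e'' \<in> ?A" for e''
        using that fin e'(2) by simp
      then have "top e'" using e'(1) by (simp add: top_def)
      moreover have "c e < c e'"
      proof -
        obtain e'' where "e'' \<in> ?A" "c e < c e''"
          using \<open>e \<in> F\<close> \<open>\<not> top e\<close> by (auto simp: top_def not_le)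
        then show ?thesis using \<open>\<And>e''. e'' \<in> ?A \<Longrightarrow> c e'' \<le> c e'\<close> by (meson less_le_trans)
      qed
      ultimately show ?thesis using e'(1) by blast
    qed
    have "{e. top e} \<subseteq> F" by (auto simp: top_def)
    moreover have "\<forall>e\<in>{e. top e}. \<forall>e'\<in>{e. top e}. e \<noteq> e' \<longrightarrow> s e \<noteq> s e' \<and> t e \<noteq> t e'"
      using indep by simp
    moreover have "\<forall>e\<in>F - {e. top e}. \<exists>e'\<in>{e. top e}.
        (s e' = s e \<and> c e < c e') \<or> (t e' = t e \<and> c e' < c e)"
      using dominated by simp blast
    ultimately show ?thesis by (intro exI[of _ "{e. top e}"] conjI)
  qed
qed

text \<open>Galvin's argument: the edges whose list contains a fixed colour have a stable matching;
  give it that colour. Every other such edge loses a preferred neighbour along with the colour.\<close>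
lemma list_coloring_of_preferences:
  fixes s :: "'e \<Rightarrow> 'v" and t :: "'e \<Rightarrow> 'u" and c :: "'e \<Rightarrow> nat" and L :: "'e \<Rightarrow> nat set"
  assumes "finite E"
    and "\<forall>e\<in>E. \<forall>e'\<in>E. e \<noteq> e' \<and> (s e = s e' \<or> t e = t e') \<longrightarrow> c e \<noteq> c e'"
    and "\<forall>e\<in>E. finite (L e) \<and> card {e'\<in>E. s e' = s e \<and> c e < c e'}
           + card {e'\<in>E. t e' = t e \<and> c e' < c e} < card (L e)"
  shows "\<exists>g. (\<forall>e\<in>E. g e \<in> L e) \<and>
    (\<forall>e\<in>E. \<forall>e'\<in>E. e \<noteq> e' \<and> (s e = s e' \<or> t e = t e') \<longrightarrow> g e \<noteq> g e')"
  using assms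
proof (induction E arbitrary: L rule: finite_psubset_induct)
  case (psubset E)
  show ?case
  proof (cases "E = {}")
    case False
    then obtain e0 where e0: "e0 \<in> E" by blast
    then have "L e0 \<noteq> {}" using psubset.prems(2) by fastforce
    then obtain a where a: "a \<in> L e0" by blast
    define F where "F = {e\<in>E. a \<in> L e}"
    have "F \<subseteq> E" by (auto simp: F_def)
    have "finite F" using psubset.hyps by (simp add: F_def)
    moreover have "\<forall>e\<in>F. \<forall>e'\<in>F. e \<noteq> e' \<and> (s e = s e' \<or> t e = t e') \<longrightarrow> c e \<noteq> c e'"
      using psubset.prems(1) \<open>F \<subseteq> E\<close> by blast
    ultimately have "\<exists>K\<subseteq>F. (\<forall>e\<in>K. \<forall>e'\<in>K. e \<noteq> e' \<longrightarrow> s e \<noteq> s e' \<and> t e \<noteq> t e') \<and>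
      (\<forall>e\<in>F - K. \<exists>e'\<in>K. (s e' = s e \<and> c e < c e') \<or> (t e' = t e \<and> c e' < c e))"
      by (rule stable_matching_exists)
    then obtain K where K: "K \<subseteq> F"
      "\<forall>e\<in>K. \<forall>e'\<in>K. e \<noteq> e' \<longrightarrow> s e \<noteq> s e' \<and> t e \<noteq> t e'"
      "\<forall>e\<in>F - K. \<exists>e'\<in>K. (s e' = s e \<and> c e < c e') \<or> (t e' = t e \<and> c e' < c e)"
      by (elim exE conjE) (rule that)
    have "e0 \<in> F" using e0 a by (simp add: F_def)
    then have "K \<noteq> {}" using K(3) by auto
    then have sub: "E - K \<subset> E" using K(1) by (auto simp: F_def)
    have lists: "finite (L e - {a}) \<and> card {e'\<in>E - K. s e' = s e \<and> c e < c e'}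
           + card {e'\<in>E - K. t e' = t e \<and> c e' < c e} < card (L e - {a})" if "e \<in> E - K" for e
    proof -
      let ?S = "{e'\<in>E. s e' = s e \<and> c e < c e'}" and ?T = "{e'\<in>E. t e' = t e \<and> c e' < c e}"
      let ?S' = "{e'\<in>E - K. s e' = s e \<and> c e < c e'}" and ?T' = "{e'\<in>E - K. t e' = t e \<and> c e' < c e}"
      have fin: "finite ?S" "finite ?T" "finite (L e)" using psubset that by auto
      have old: "card ?S + card ?T < card (L e)" using psubset.prems(2) that by blast
      have mono: "card ?S' \<le> card ?S" "card ?T' \<le> card ?T"
        using fin by (auto intro!: card_mono)
      show ?thesis
      proof (cases "a \<in> L e")
        case True
        then have "e \<in> F - K" using that by (simp add: F_def)
        then obtain e' where e': "e' \<in> K" "(s e' = s e \<and> c e < c e') \<or> (t e' = t e \<and> c e' < c e)"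
          using K(3) by blast
        have "e' \<in> E" using e'(1) K(1) by (auto simp: F_def)
        then have "?S' \<subset> ?S \<or> ?T' \<subset> ?T" using e' by blast
        then have "card ?S' < card ?S \<or> card ?T' < card ?T"
          using psubset_card_mono[OF fin(1)] psubset_card_mono[OF fin(2)] by blast
        moreover have "card (L e - {a}) = card (L e) - 1" using True fin by simp
        ultimately show ?thesis using old mono fin by auto
      next
        case False
        then show ?thesis using old mono fin by simp
      qed
    qed
    obtain g where g: "\<forall>e\<in>E - K. g e \<in> L e - {a}"
      "\<forall>e\<in>E - K. \<forall>e'\<in>E - K. e \<noteq> e' \<and> (s e = s e' \<or> t e = t e') \<longrightarrow> g e \<noteq> g e'"
      using psubset.IH[OF sub, of "\<lambda>e. L e - {a}"] psubset.prems(1) lists by auto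
    show ?thesis
      using g K(1,2) by (intro exI[of _ "\<lambda>e. if e \<in> K then a else g e"]) (auto simp: F_def)
  qed simp
qed

section \<open>Koenig colourings and the rooted bipartite case\<close>

lemma proper_edge_coloringD:
  "proper_edge_coloring E f \<Longrightarrow> e1 \<in> E \<Longrightarrow> e2 \<in> E \<Longrightarrow> v \<in> e1 \<Longrightarrow> v \<in> e2 \<Longrightarrow> f e1 = f e2 \<Longrightarrow> e1 = e2"
  unfolding proper_edge_coloring_def by blast

lemma proper_edge_coloringI:
  "(\<And>e1 e2 v. e1 \<in> E \<Longrightarrow> e2 \<in> E \<Longrightarrow> v \<in> e1 \<Longrightarrow> v \<in> e2 \<Longrightarrow> e1 \<noteq> e2 \<Longrightarrow> f e1 \<noteq> f e2)
    \<Longrightarrow> proper_edge_coloring E f"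
  unfolding proper_edge_coloring_def by blast

lemma proper_edge_coloring_inj_on:
  "proper_edge_coloring E f \<Longrightarrow> inj_on f {e \<in> E. v \<in> e}"
  by (auto simp: inj_on_def dest: proper_edge_coloringD)

text \<open>Koenig's theorem, one edge \<open>{x, y}\<close> at a time: \<open>a\<close> is free at
  \<open>x\<close> and \<open>b\<close> at \<open>y\<close>. The \<open>a\<close>/\<open>b\<close>
  component of \<open>y\<close> misses \<open>x\<close>, so exchanging the two colours on it makes
  \<open>a\<close> free at both ends.\<close>

lemma bipartite_edge_coloring:
  assumes "finite E" "bipartition f E" "\<forall>v. deg E v \<le> k"
  shows "\<exists>c::'a set \<Rightarrow> nat. proper_edge_coloring E c \<and> (\<forall>e\<in>E. c e < k)"
  using assms
proof (induction E rule: finite_induct)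
  case empty
  then show ?case by (auto simp: proper_edge_coloring_def)
next
  case (insert e E)
  have bip: "bipartition f E" using insert.prems by (simp add: bipartition_def)
  have deg_le: "deg E v \<le> deg (insert e E) v" for v
    unfolding deg_def using insert.hyps by (intro card_mono) auto
  have "\<forall>v. deg E v \<le> k" using deg_le insert.prems(2) le_trans by blast
  then obtain c :: "'a set \<Rightarrow> nat" where c: "proper_edge_coloring E c" "\<forall>e\<in>E. c e < k"
    using insert.IH bip by blast
  obtain x y where e: "e = {x, y}" "f x" "\<not> f y"
    using insert.prems(1) by (auto simp: bipartition_def)
  have free: "\<exists>a<k. \<forall>e'\<in>E. v \<in> e' \<longrightarrow> c e' \<noteq> a" if "v \<in> e" for v
  proof -
    have "{e' \<in> insert e E. v \<in> e'} = insert e {e' \<in> E. v \<in> e'}" using that by auto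
    then have "deg (insert e E) v = Suc (deg E v)"
      using insert.hyps by (simp add: deg_def)
    then have "deg E v < k" using insert.prems(2) by (metis Suc_le_lessD)
    then have "card (c ` {e' \<in> E. v \<in> e'}) < card {..<k}"
      using card_image_le[of "{e' \<in> E. v \<in> e'}" c] insert.hyps by (simp add: deg_def)
    then have "\<not> {..<k} \<subseteq> c ` {e' \<in> E. v \<in> e'}"
      using card_mono[of "c ` {e' \<in> E. v \<in> e'}" "{..<k}"] insert.hyps by force
    then show ?thesis by blast
  qed
  obtain a where a: "a < k" "\<forall>e'\<in>E. x \<in> e' \<longrightarrow> c e' \<noteq> a" using free[of x] e by auto
  obtain b where b: "b < k" "\<forall>e'\<in>E. y \<in> e' \<longrightarrow> c e' \<noteq> b" using free[of y] e by auto
  have other: "f p \<noteq> f q" if "{p, q} \<in> E" for p q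
    using bip that unfolding bipartition_def by (metis doubleton_eq_iff)
  \<comment> \<open>Kempe chain from \<open>y\<close>, directed: it can enter the side of \<open>x\<close> only along colour \<open>a\<close>.\<close>
  define R where "R p q \<longleftrightarrow> {p, q} \<in> E \<and> c {p, q} = (if f p then b else a)" for p q
  define K where "K = {z. R\<^sup>*\<^sup>* y z}"
  have pred: "z = y \<or> (\<exists>p\<in>K. R p z)" if "z \<in> K" for z
    using that unfolding K_def by (auto elim: rtranclp.cases)
  have "y \<in> K" by (simp add: K_def)
  have "x \<notin> K"
  proof
    assume "x \<in> K"
    then obtain p where "R p x" using pred e by blast
    then show False using a(2) other[of p x] e by (auto simp: R_def)
  qed
  \<comment> \<open>The directed relation still captures every \<open>a\<close>/\<open>b\<close>
    edge at \<open>z\<close>: the colour by which \<open>R\<close> does not leave \<open>z\<close>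
    is the one by which \<open>z\<close> was entered, and properness allows only one such edge. At
    \<open>y\<close> that colour is \<open>b\<close>, which is free there.\<close>
  have closed: "q \<in> K" if "z \<in> K" "{z, q} \<in> E" "c {z, q} \<in> {a, b}" for z q
  proof (cases "R z q")
    case True
    then show ?thesis using that(1) unfolding K_def by (auto intro: rtranclp.rtrancl_into_rtrancl)
  next
    case False
    then have col: "c {z, q} = (if f z then a else b)" "c {z, q} \<noteq> (if f z then b else a)"
      using that by (auto simp: R_def)
    have "z \<noteq> y" using col b(2) that(2) e by auto
    then obtain p where p: "p \<in> K" "R p z" using pred \<open>z \<in> K\<close> by blast
    then have "c {p, z} = c {z, q}" using col other[of p z] by (auto simp: R_def)
    then have "{p, z} = {z, q}"
      using proper_edge_coloringD[OF c(1), of "{p, z}" "{z, q}" z] p(2) that(2) by (simp add: R_def)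
    then have "p = q" by (auto simp: doubleton_eq_iff)
    then show ?thesis using p by simp
  qed
  have closed': "e' \<subseteq> K" if "e' \<in> E" "c e' \<in> {a, b}" "e' \<inter> K \<noteq> {}" for e'
  proof -
    obtain p q where pq: "e' = {p, q}" using bip \<open>e' \<in> E\<close> by (auto simp: bipartition_def)
    then show ?thesis using that closed[of p q] closed[of q p] by (auto simp: insert_commute)
  qed
  define d where "d e' = (if e' = e then a else if e' \<inter> K = {} then c e'
    else if c e' = a then b else if c e' = b then a else c e')" for e'
  have d_in: "d e' = (if c e' = a then b else if c e' = b then a else c e')"
    if "e' \<in> E" "z \<in> e'" "z \<in> K" for e' z
    using that insert.hyps by (auto simp: d_def)
  have d_out: "d e' = c e'" if "e' \<in> E" "z \<in> e'" "z \<notin> K" for e' z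
    using that insert.hyps closed'[of e'] by (auto simp: d_def)
  have "d e1 \<noteq> d e2" if "e1 \<in> E" "e2 \<in> E" "v \<in> e1" "v \<in> e2" "e1 \<noteq> e2" for e1 e2 v
  proof -
    have "c e1 \<noteq> c e2" using that proper_edge_coloringD[OF c(1)] by blast
    then show ?thesis using that d_in[of e1 v] d_in[of e2 v] d_out[of e1 v] d_out[of e2 v]
      by (cases "v \<in> K") (auto split: if_splits)
  qed
  moreover have "d e1 \<noteq> d e" if "e1 \<in> E" "v \<in> e1" "v \<in> e" for e1 v
  proof (cases "v = x")
    case True
    then show ?thesis using that a(2) d_out[of e1 x] \<open>x \<notin> K\<close> by (auto simp: d_def)
  next
    case False
    then have "v = y" using that e by auto
    moreover have "c e1 \<noteq> b" using b(2) that \<open>v = y\<close> by blast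
    ultimately show ?thesis using that d_in[of e1 y] \<open>y \<in> K\<close> by (auto simp: d_def)
  qed
  ultimately have "proper_edge_coloring (insert e E) d"
    by (intro proper_edge_coloringI) (metis insertE)
  moreover have "\<forall>e'\<in>insert e E. d e' < k" using a(1) b(1) c(2) by (auto simp: d_def)
  ultimately show ?case by blast
qed

text \<open>Serves to rename the colours of a Koenig colouring so that those at the root become the
  smallest.\<close>

lemma permutation_onto_initial_segment:
  assumes "A \<subseteq> {..<k}"
  shows "\<exists>p::nat \<Rightarrow> nat. inj_on p {..<k} \<and> p ` {..<k} \<subseteq> {..<k} \<and> p ` A \<subseteq> {..<card A}"
proof -
  have fin: "finite A" using assms finite_subset by blast
  have le: "card A \<le> k" using card_mono[OF _ assms] by simp
  obtain p1 where p1: "bij_betw p1 A {..<card A}"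
    using finite_same_card_bij[of A "{..<card A}"] fin by auto
  have "card ({..<k} - A) = card {card A..<k}" using card_Diff_subset[OF fin assms] by simp
  then obtain p2 where p2: "bij_betw p2 ({..<k} - A) {card A..<k}"
    using finite_same_card_bij[of "{..<k} - A" "{card A..<k}"] by auto
  define p where "p x = (if x \<in> A then p1 x else p2 x)" for x
  have "bij_betw p (A \<union> ({..<k} - A)) ({..<card A} \<union> {card A..<k})"
    unfolding p_def by (rule bij_betw_disjoint_Un[OF p1 p2]) auto
  moreover have "A \<union> ({..<k} - A) = {..<k}" "{..<card A} \<union> {card A..<k} = {..<k}"
    using assms le by auto
  ultimately have "bij_betw p {..<k} {..<k}" by simp
  moreover have "p ` A \<subseteq> {..<card A}" using p1 by (auto simp: p_def bij_betw_def)
  ultimately show ?thesis unfolding bij_betw_def by blast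
qed

text \<open>If all colours at the \<open>s\<close> end of \<open>e\<close> lie below
  \<open>m\<close>, then \<open>e\<close> has at most \<open>m - 1 - c e\<close> preferred
  neighbours there and at most \<open>c e\<close> at the \<open>t\<close> end, together fewer than
  \<open>m\<close>. In general \<open>m = k\<close>; for edges at \<open>w\<close> the value
  \<open>m = deg E w\<close> works because \<open>w\<close> is put on the \<open>s\<close> side and
  holds the smallest colours.\<close>

lemma bipartite_list_colorable_rooted:
  assumes "finite E" "bipartition f E" "\<forall>v. deg E v \<le> k"
    and L: "\<forall>e\<in>E. finite (L e) \<and> (if w \<in> e then deg E w else k) \<le> card (L e)"
  shows "list_colorable E L"
proof -
  obtain h where bip: "bipartition h E" and hw: "h w"
  proof (cases "f w")
    case False
    have "bipartition (\<lambda>v. \<not> f v) E"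
      using assms(2) unfolding bipartition_def by (metis insert_commute)
    then show ?thesis using False that by blast
  qed (use assms(2) that in blast)
  obtain c0 :: "'a set \<Rightarrow> nat" where c0: "proper_edge_coloring E c0" "\<forall>e\<in>E. c0 e < k"
    using bipartite_edge_coloring[OF assms(1-3)] by blast
  have "c0 ` {e \<in> E. w \<in> e} \<subseteq> {..<k}" using c0 by auto
  from permutation_onto_initial_segment[OF this] obtain p where
    p: "inj_on p {..<k}" "p ` {..<k} \<subseteq> {..<k}" "p ` (c0 ` {e \<in> E. w \<in> e}) \<subseteq> {..<deg E w}"
    using card_image[OF proper_edge_coloring_inj_on[OF c0(1), of w]] by (auto simp: deg_def)
  define c where "c e = p (c0 e)" for e
  have c: "proper_edge_coloring E c"
  proof (rule proper_edge_coloringI)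
    fix e1 e2 v
    assume "e1 \<in> E" "e2 \<in> E" "v \<in> e1" "v \<in> e2" "e1 \<noteq> e2"
    then show "c e1 \<noteq> c e2"
      using proper_edge_coloringD[OF c0(1)] c0(2) p(1) unfolding c_def inj_on_def by (meson lessThan_iff)
  qed
  have c_k: "c e < k" if "e \<in> E" for e using c0(2) p(2) that by (auto simp: c_def)
  have c_w: "c e < deg E w" if "e \<in> E" "w \<in> e" for e using p(3) that by (auto simp: c_def)
  define s where "s e = (THE v. v \<in> e \<and> h v)" for e
  define t where "t e = (THE v. v \<in> e \<and> \<not> h v)" for e
  have st: "e = {s e, t e} \<and> h (s e) \<and> \<not> h (t e)" if "e \<in> E" for e
  proof -
    obtain x y where xy: "e = {x, y}" "h x" "\<not> h y"
      using bip \<open>e \<in> E\<close> by (auto simp: bipartition_def)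
    then have "s e = x" "t e = y" unfolding s_def t_def by (auto intro!: the_equality)
    then show ?thesis using xy by simp
  qed
  have share: "s e = s e' \<or> t e = t e' \<longleftrightarrow> e \<inter> e' \<noteq> {}" if "e \<in> E" "e' \<in> E" for e e'
  proof -
    obtain x y where "e = {x, y}" "s e = x" "t e = y" "h x" "\<not> h y" using st[OF \<open>e \<in> E\<close>] by blast
    moreover obtain x' y' where "e' = {x', y'}" "s e' = x'" "t e' = y'" "h x'" "\<not> h y'"
      using st[OF \<open>e' \<in> E\<close>] by blast
    ultimately show ?thesis by auto
  qed
  have inj: "\<forall>e\<in>E. \<forall>e'\<in>E. e \<noteq> e' \<and> (s e = s e' \<or> t e = t e') \<longrightarrow> c e \<noteq> c e'"
  proof (intro ballI impI)
    fix e e' assume "e \<in> E" "e' \<in> E" "e \<noteq> e' \<and> (s e = s e' \<or> t e = t e')"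
    then show "c e \<noteq> c e'" using c share[of e e'] by (simp add: proper_edge_coloring_def)
  qed
  have lists: "finite (L e) \<and> card {e'\<in>E. s e' = s e \<and> c e < c e'}
           + card {e'\<in>E. t e' = t e \<and> c e' < c e} < card (L e)" if "e \<in> E" for e
  proof -
    let ?S = "{e'\<in>E. s e' = s e \<and> c e < c e'}" and ?T = "{e'\<in>E. t e' = t e \<and> c e' < c e}"
    define m where "m = (if w \<in> e then deg E w else k)"
    have m: "c e < m" using c_k c_w that by (simp add: m_def)
    have "c ` ?S \<subseteq> {c e<..<m}"
    proof
      fix z assume "z \<in> c ` ?S"
      then obtain e' where e': "e' \<in> E" "s e' = s e" "c e < c e'" "z = c e'" by blast
      have "w \<in> e'" if "w \<in> e"
      proof -
        have "w = s e" using st[OF \<open>e \<in> E\<close>] hw that by (metis insertE singletonD)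
        then show ?thesis using st[OF e'(1)] e'(2) by (metis insertI1)
      qed
      then show "z \<in> {c e<..<m}" using e' c_k c_w by (auto simp: m_def)
    qed
    moreover have "inj_on c ?S"
      using inj by (intro inj_onI) (metis (mono_tags, lifting) mem_Collect_eq)
    ultimately have 1: "card ?S \<le> card {c e<..<m}"
      using card_inj_on_le[of c ?S "{c e<..<m}"] by blast
    have "c ` ?T \<subseteq> {..<c e}" by auto
    moreover have "inj_on c ?T"
      using inj by (intro inj_onI) (metis (mono_tags, lifting) mem_Collect_eq)
    ultimately have 2: "card ?T \<le> card {..<c e}"
      using card_inj_on_le[of c ?T "{..<c e}"] by blast
    have "card ?S + card ?T < m" using 1 2 m by simp
    then show ?thesis using L that by (fastforce simp: m_def)
  qed
  have "\<exists>g. (\<forall>e\<in>E. g e \<in> L e) \<and>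
    (\<forall>e\<in>E. \<forall>e'\<in>E. e \<noteq> e' \<and> (s e = s e' \<or> t e = t e') \<longrightarrow> g e \<noteq> g e')"
    using lists by (intro list_coloring_of_preferences[OF assms(1) inj] ballI)
  then obtain g where "\<forall>e\<in>E. g e \<in> L e"
    "\<forall>e\<in>E. \<forall>e'\<in>E. e \<noteq> e' \<and> (s e = s e' \<or> t e = t e') \<longrightarrow> g e \<noteq> g e'"
    by (elim exE conjE) (rule that)
  then have "proper_edge_coloring E g \<and> (\<forall>e\<in>E. g e \<in> L e)"
    by (simp add: proper_edge_coloring_def share)
  then show ?thesis unfolding list_colorable_def by blast
qed

section \<open>Paths, cycles and ears\<close>

fun path_edges :: "'a list \<Rightarrow> 'a set set" where
  "path_edges (x # y # zs) = insert {x, y} (path_edges (y # zs))"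
| "path_edges _ = {}"

lemma path_edges_append:
  "path_edges (xs @ y # ys) = path_edges (xs @ [y]) \<union> path_edges (y # ys)"
  by (induction xs rule: path_edges.induct) auto

lemma path_edges_Cons: "A \<noteq> [] \<Longrightarrow> path_edges (x # A) = insert {x, hd A} (path_edges A)"
  by (cases A) auto

lemma path_edges_snoc: "A \<noteq> [] \<Longrightarrow> path_edges (A @ [x]) = insert {last A, x} (path_edges A)"
  by (induction A rule: path_edges.induct) auto

lemma path_edges_append_append:
  "path_edges (xs @ y # ys @ z # zs) = path_edges (xs @ [y]) \<union> path_edges (y # ys @ [z]) \<union> path_edges (z # zs)"
  using path_edges_append[of xs y "ys @ z # zs"] path_edges_append[of "y # ys" z zs] by auto

lemma path_edges_rev: "path_edges (rev xs) = path_edges xs"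
proof (induction xs rule: path_edges.induct)
  case (1 x y zs)
  then show ?case
    using path_edges_append[of "rev zs" y "[x]"] by (simp add: insert_commute)
qed auto

lemma path_edges_subset: "e \<in> path_edges xs \<Longrightarrow> e \<subseteq> set xs"
  by (induction xs rule: path_edges.induct) auto

lemma path_edges_nth: "path_edges xs = {{xs ! i, xs ! Suc i} | i. Suc i < length xs}"
proof (induction xs rule: path_edges.induct)
  case (1 x y zs)
  have "{{(x # y # zs) ! i, (x # y # zs) ! Suc i} | i. Suc i < length (x # y # zs)}
    = insert {x, y} {{(y # zs) ! i, (y # zs) ! Suc i} | i. Suc i < length (y # zs)}" (is "?A = insert _ ?B")
  proof (intro equalityI subsetI)
    fix e assume "e \<in> ?A"
    then obtain i where i: "e = {(x # y # zs) ! i, (x # y # zs) ! Suc i}" "Suc i < length (x # y # zs)" by blast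
    then show "e \<in> insert {x, y} ?B" by (cases i) auto
  next
    fix e assume "e \<in> insert {x, y} ?B"
    then consider "e = {x, y}" | i where "e = {(y # zs) ! i, (y # zs) ! Suc i}" "Suc i < length (y # zs)" by blast
    then show "e \<in> ?A"
    proof cases
      case 1
      then show ?thesis by (intro CollectI exI[of _ 0]) auto
    next
      case 2
      then show ?thesis by (intro CollectI exI[of _ "Suc i"]) auto
    qed
  qed
  then show ?case using 1 by simp
qed auto

lemma cycle_edges_eq:
  assumes "vs \<noteq> []"
  shows "cycle_edges vs = path_edges (vs @ [hd vs])"
proof -
  have "(vs @ [hd vs]) ! Suc i = vs ! (Suc i mod length vs)" if "i < length vs" for i
    using that assms by (cases "Suc i = length vs") (auto simp: nth_append hd_conv_nth)
  then show ?thesis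
    unfolding cycle_edges_def path_edges_nth
    by (intro Collect_cong) (auto simp: nth_append)
qed

lemma cycle_edges_Cons: "cycle_edges (x # xs) = path_edges (x # xs @ [x])"
  by (simp add: cycle_edges_eq)

lemma is_cycle_list_iff:
  "is_cycle_list E vs \<longleftrightarrow> length vs \<ge> 3 \<and> distinct vs \<and> cycle_edges vs \<subseteq> E"
  unfolding is_cycle_list_def cycle_edges_def by auto

lemma cycle_edges_rotate: "cycle_edges (xs @ ys) = cycle_edges (ys @ xs)"
proof (cases "xs = [] \<or> ys = []")
  case False
  then obtain x xs' y ys' where "xs = x # xs'" "ys = y # ys'" by (meson neq_Nil_conv)
  then show ?thesis
    using path_edges_append_append[of "[]" x xs' y "ys' @ [x]"] path_edges_append_append[of "[]" y ys' x "xs' @ [y]"]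
    by (auto simp: cycle_edges_Cons)
qed auto

lemma cycle_edges_rev: "cycle_edges (rev vs) = cycle_edges vs"
proof (cases vs)
  case (Cons x xs)
  have "cycle_edges (rev vs) = cycle_edges (x # rev xs)"
    using cycle_edges_rotate[of "rev xs" "[x]"] Cons by simp
  also have "\<dots> = path_edges (rev (x # xs @ [x]))" by (simp add: cycle_edges_Cons)
  also have "\<dots> = cycle_edges vs" by (simp only: path_edges_rev Cons cycle_edges_Cons)
  finally show ?thesis .
qed simp

lemma closing_edge_notin_path_edges:
  assumes "distinct xs" "length xs \<ge> 3"
  shows "{hd xs, last xs} \<notin> path_edges xs"
proof -
  obtain x y z zs where xs: "xs = x # y # z # zs"
    using assms(2) by (auto simp: Suc_le_length_iff numeral_3_eq_3)
  have "last xs \<in> set (z # zs)" using xs by simp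
  then have "{x, last xs} \<noteq> {x, y}" using assms(1) xs by (auto simp: doubleton_eq_iff)
  moreover have "{x, last xs} \<notin> path_edges (y # z # zs)"
    using path_edges_subset[of "{x, last xs}" "y # z # zs"] assms(1) xs by auto
  ultimately show ?thesis using xs by simp
qed

lemma cycle_edges_Cons_snoc: "cycle_edges (y # B @ [x]) = insert {x, y} (path_edges (y # B @ [x]))"
  using path_edges_append[of "y # B" x "[y]"] by (simp add: cycle_edges_Cons)

lemma card_path_edges: "distinct xs \<Longrightarrow> finite (path_edges xs) \<and> card (path_edges xs) = length xs - 1"
proof (induction xs rule: path_edges.induct)
  case (1 x y zs)
  then have "{x, y} \<notin> path_edges (y # zs)" using path_edges_subset[of "{x, y}" "y # zs"] by auto
  then show ?case using 1 by simp
qed auto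

lemma card_cycle_edges:
  assumes "distinct vs" "length vs \<ge> 3"
  shows "finite (cycle_edges vs) \<and> card (cycle_edges vs) = length vs"
proof -
  obtain y B x where vs: "vs = y # B @ [x]"
    using assms(2) by (metis One_nat_def Suc_le_length_iff append_butlast_last_id list.size(3) not_less_eq_eq numeral_3_eq_3 le0)
  then show ?thesis
    using closing_edge_notin_path_edges[OF assms] card_path_edges[OF assms(1)]
    by (simp add: cycle_edges_Cons_snoc insert_commute)
qed

lemma cycle_start:
  assumes "is_cycle_list E vs" "x \<in> set vs"
  obtains A where "is_cycle_list E (x # A)" "set (x # A) = set vs"
    "cycle_edges (x # A) = cycle_edges vs" "length (x # A) = length vs"
proof -
  obtain P Q where vs: "vs = P @ x # Q" using assms(2) by (meson split_list)
  have "cycle_edges (x # Q @ P) = cycle_edges vs" using cycle_edges_rotate[of P "x # Q"] vs by simp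
  then show ?thesis using assms(1) vs by (intro that[of "Q @ P"]) (auto simp: is_cycle_list_iff)
qed

lemma cycle_split:
  assumes "is_cycle_list E vs" "x \<in> set vs" "y \<in> set vs" "x \<noteq> y"
  obtains A B where "is_cycle_list E (x # A @ y # B)" "set (x # A @ y # B) = set vs"
    "cycle_edges (x # A @ y # B) = cycle_edges vs" "length (x # A @ y # B) = length vs"
proof -
  obtain A where A: "is_cycle_list E (x # A)" "set (x # A) = set vs"
    "cycle_edges (x # A) = cycle_edges vs" "length (x # A) = length vs"
    using cycle_start[OF assms(1,2)] by blast
  then have "y \<in> set A" using assms(3,4) by auto
  then obtain P Q where "A = P @ y # Q" by (meson split_list)
  then show ?thesis using that A by blast
qed

text \<open>Rotation by \<open>Suc i\<close> turns the \<open>i\<close>-th edge into the closing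
  one; reversal takes care of its other orientation.\<close>

lemma cycle_edge_split:
  assumes "is_cycle_list E vs" "{x, y} \<in> cycle_edges vs"
  obtains B where "is_cycle_list E (y # B @ [x])" "set (y # B @ [x]) = set vs"
    "cycle_edges (y # B @ [x]) = cycle_edges vs" "length (y # B @ [x]) = length vs"
proof -
  obtain i where i: "i < length vs" "{x, y} = {vs ! i, vs ! (Suc i mod length vs)}"
    using assms(2) by (auto simp: cycle_edges_def)
  define us where "us = rotate (Suc i) vs"
  have len: "length vs \<ge> 3" using assms(1) by (simp add: is_cycle_list_iff)
  then have ne: "vs \<noteq> []" "us \<noteq> []" by (auto simp: us_def)
  have hd: "hd us = vs ! (Suc i mod length vs)" 
    using ne by (simp add: us_def hd_rotate_conv_nth del: rotate_Suc)
  have "last us = vs ! ((Suc i + (length vs - 1)) mod length vs)"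
    using ne by (simp add: us_def last_conv_nth nth_rotate del: rotate_Suc)
  moreover have "(Suc i + (length vs - 1)) mod length vs = i"
  proof -
    have "Suc i + (length vs - 1) = i + length vs" using len by simp
    then show ?thesis using i(1) by simp
  qed
  ultimately have last: "last us = vs ! i" by simp
  have us_edges: "cycle_edges us = cycle_edges vs"
    unfolding us_def rotate_drop_take
    using cycle_edges_rotate[of "drop (Suc i mod length vs) vs" "take (Suc i mod length vs) vs"] by simp
  have "length us = length vs" "set us = set vs" "distinct us"
    using assms(1) by (simp_all add: us_def is_cycle_list_iff)
  note us = this us_edges
  obtain b B a where B: "us = b # B @ [a]"
    using len us(1) by (metis One_nat_def Suc_le_length_iff append_butlast_last_id list.size(3) not_less_eq_eq numeral_3_eq_3 le0)
  then have "{x, y} = {a, b}" using i(2) hd last by simp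
  then consider "x = a" "y = b" | "x = b" "y = a" by (auto simp: doubleton_eq_iff)
  then show ?thesis
  proof cases
    case 1
    then show ?thesis using us B assms(1) by (intro that[of B]) (auto simp: is_cycle_list_iff)
  next
    case 2
    have "rev us = a # rev B @ [b]" using B by simp
    then show ?thesis using us B assms(1) 2 cycle_edges_rev[of us]
      by (intro that[of "rev B"]) (auto simp: is_cycle_list_iff)
  qed
qed

text \<open>The cycle condition of \<open>in_G_star\<close> without the vertex set, in a form that
  passes to every subset of the edges.\<close>

definition odd_cycles_share_at_most_one :: "'a set set \<Rightarrow> bool" where
  "odd_cycles_share_at_most_one E \<longleftrightarrow>
    (\<forall>C1\<in>odd_cycles E. \<forall>C2\<in>odd_cycles E. C1 \<noteq> C2 \<longrightarrow> card (C1 \<inter> C2) \<le> 1)"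

lemma odd_cycles_share_at_most_one_mono:
  assumes "odd_cycles_share_at_most_one E" "F \<subseteq> E"
  shows "odd_cycles_share_at_most_one F"
proof -
  have "odd_cycles F \<subseteq> odd_cycles E"
    using assms(2) unfolding odd_cycles_def is_cycle_list_iff by blast
  then show ?thesis using assms(1) unfolding odd_cycles_share_at_most_one_def by blast
qed

lemma odd_cycles_eqI:
  assumes "odd_cycles_share_at_most_one E" "is_cycle_list E vs" "odd (length vs)"
    "is_cycle_list E us" "odd (length us)"
    "e1 \<noteq> e2" "{e1, e2} \<subseteq> cycle_edges vs" "{e1, e2} \<subseteq> cycle_edges us"
  shows "cycle_edges vs = cycle_edges us"
proof (rule ccontr)
  assume "cycle_edges vs \<noteq> cycle_edges us"
  then have "card (cycle_edges vs \<inter> cycle_edges us) \<le> 1"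
    using assms unfolding odd_cycles_share_at_most_one_def odd_cycles_def by blast
  moreover have "card {e1, e2} \<le> card (cycle_edges vs \<inter> cycle_edges us)"
    using assms card_cycle_edges[of vs] by (intro card_mono) (auto simp: is_cycle_list_iff)
  ultimately show False using assms(6) by simp
qed

text \<open>The arc through \<open>A\<close> and the ear close to an odd cycle \<open>?D\<close>. If
  \<open>A\<close> had a vertex, the first and last edge of the arc would be two common edges, so
  both cycles would coincide; but the ear has a vertex off \<open>?C\<close> or, if \<open>M\<close>
  is empty, \<open>B\<close> has a vertex off \<open>?D\<close>. The last assumption excludes the
  case where the ear is the other arc itself.\<close>

lemma odd_arc_with_ear_is_edge:
  assumes share: "odd_cycles_share_at_most_one E"
    and cyc: "is_cycle_list E (x # A @ y # B)" "odd (length (x # A @ y # B))"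
    and ear: "distinct M" "set M \<inter> set (x # A @ y # B) = {}" "path_edges (x # M @ [y]) \<subseteq> E"
    and "odd (length A + length M)" "M \<noteq> [] \<or> B \<noteq> []"
  shows "A = []"
proof (rule ccontr)
  assume "A \<noteq> []"
  let ?C = "x # A @ y # B" and ?D = "x # A @ y # rev M"
  have C: "cycle_edges ?C = path_edges (x # A @ [y]) \<union> path_edges (y # B @ [x])"
    using path_edges_append[of "x # A" y "B @ [x]"] by (simp add: cycle_edges_Cons)
  have rev: "path_edges (y # rev M @ [x]) = path_edges (x # M @ [y])"
    using path_edges_rev[of "x # M @ [y]"] by simp
  have D: "cycle_edges ?D = path_edges (x # A @ [y]) \<union> path_edges (x # M @ [y])"
    using path_edges_append[of "x # A" y "rev M @ [x]"] rev by (simp add: cycle_edges_Cons)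
  have dist: "distinct ?C" "cycle_edges ?C \<subseteq> E" using cyc(1) by (simp_all add: is_cycle_list_iff)
  have "length ?D \<ge> 3" using \<open>A \<noteq> []\<close> by (cases A) auto
  moreover have "distinct ?D" using dist ear by auto
  ultimately have cycD: "is_cycle_list E ?D" "odd (length ?D)"
    using dist(2) C D ear(3) assms(7) by (auto simp: is_cycle_list_iff)
  let ?e1 = "{x, hd A}" and ?e2 = "{last A, y}"
  have ends: "hd A \<in> set A" "last A \<in> set A" using \<open>A \<noteq> []\<close> by auto
  have "?e1 \<noteq> ?e2" using dist(1) ends by (auto simp: doubleton_eq_iff)
  moreover have "?e1 \<in> path_edges (x # A @ [y])" using \<open>A \<noteq> []\<close> by (cases A) auto
  moreover have "?e2 \<in> path_edges (x # A @ [y])"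
    using \<open>A \<noteq> []\<close> path_edges_snoc[of "x # A" y] by simp
  ultimately have eq: "cycle_edges ?C = cycle_edges ?D"
    unfolding C D by (intro odd_cycles_eqI[OF share cyc cycD, of ?e1 ?e2, unfolded C D]) simp_all
  show False
  proof (cases "M = []")
    case True
    then have "B \<noteq> []" using assms(8) by simp
    then have "{y, hd B} \<in> cycle_edges ?C" unfolding C by (cases B) auto
    then have "{y, hd B} \<subseteq> set (x # A @ [y])"
      using eq True path_edges_subset[of "{y, hd B}" "x # A @ [y]"]
        path_edges_subset[of "{y, hd B}" "x # M @ [y]"] unfolding D by auto
    then show False using dist(1) hd_in_set[OF \<open>B \<noteq> []\<close>] by auto
  next
    case False
    then have "{x, hd M} \<in> cycle_edges ?D" unfolding D by (cases M) auto
    then have "hd M \<in> set ?C"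
      using eq path_edges_subset[of "{x, hd M}" "?C @ [x]"] by (auto simp: cycle_edges_Cons)
    then show False using ear(2) hd_in_set[OF False] by blast
  qed
qed

text \<open>An ear with an odd number of edges closes up with the even arc to a second odd cycle; the two
  share that arc, which has at least two edges. An ear with an even number of edges (an odd number
  of inner vertices) closes up with the odd arc, which is therefore a single edge.\<close>
lemma ear_of_odd_cycle:
  assumes share: "odd_cycles_share_at_most_one E"
    and cyc: "is_cycle_list E vs" "odd (length vs)"
    and ear: "x \<in> set vs" "y \<in> set vs" "x \<noteq> y" "distinct M" "set M \<inter> set vs = {}"
      "path_edges (x # M @ [y]) \<subseteq> E"
  shows "{x, y} \<in> cycle_edges vs \<and> (M \<noteq> [] \<longrightarrow> odd (length M))"
proof -
  obtain A B where AB: "is_cycle_list E (x # A @ y # B)" "set (x # A @ y # B) = set vs"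
    "cycle_edges (x # A @ y # B) = cycle_edges vs" "length (x # A @ y # B) = length vs"
    using cycle_split[OF cyc(1) ear(1-3)] by blast
  have BA: "is_cycle_list E (y # B @ x # A)"
    using AB(1) cycle_edges_rotate[of "x # A" "y # B"] by (auto simp: is_cycle_list_iff)
  have rev: "path_edges (y # rev M @ [x]) = path_edges (x # M @ [y])"
    using path_edges_rev[of "x # M @ [y]"] by simp
  have odd: "odd (length A + length B)" using AB(4) cyc(2) by (metis (no_types) add_Suc_right even_Suc length_Cons length_append)
  have A: "A = []" if "odd (length A + length M)" "M \<noteq> [] \<or> B \<noteq> []"
    using odd_arc_with_ear_is_edge[OF share AB(1) _ ear(4) _ ear(6) that] AB cyc(2) ear(5) by metis
  have B: "B = []" if "odd (length B + length M)" "M \<noteq> [] \<or> A \<noteq> []"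
    using odd_arc_with_ear_is_edge[OF share BA, of "rev M"] that AB(2) odd ear(4-6) rev
    by fastforce
  have edge: "{x, y} \<in> cycle_edges vs" if "A = [] \<or> B = []"
    using that
  proof
    assume "A = []"
    then show ?thesis using AB(3) by (auto simp: cycle_edges_Cons)
  next
    assume "B = []"
    then have "{y, x} \<in> cycle_edges (x # A @ y # B)"
      using path_edges_append[of "x # A" y "[x]"] by (simp add: cycle_edges_Cons)
    then show ?thesis using AB(3) by (simp add: insert_commute)
  qed
  \<comment> \<open>Empty \<open>M\<close> is a single edge between cycle vertices. The even arc has
    an inner vertex, so the other arc must be that very edge: odd cycles have no chords.\<close>
  show ?thesis
  proof (cases "M = []")
    case True
    then have "A = [] \<or> B = []" using A B odd by (cases "odd (length A)") auto
    then show ?thesis using edge True by blast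
  next
    case False
    have "odd (length M)"
    proof (rule ccontr)
      assume "\<not> odd (length M)"
      then have "odd (length A) \<Longrightarrow> A = []" "odd (length B) \<Longrightarrow> B = []" using A B False by auto
      then show False using odd by auto
    qed
    then have "A = [] \<or> B = []" using A B False odd by (cases "odd (length A)") auto
    then show ?thesis using edge \<open>odd (length M)\<close> by blast
  qed
qed

text \<open>The length grows by the number of inner vertices of the ear. One ear with an odd number
  of them makes an odd cycle even; a second one restores the parity.\<close>

lemma cycle_replace_edge:
  assumes "is_cycle_list E vs" "{x, y} \<in> cycle_edges vs"
    "distinct M" "set M \<inter> set vs = {}" "path_edges (x # M @ [y]) \<subseteq> E"
  obtains us where "is_cycle_list E us" "length us = length vs + length M" "set us = set vs \<union> set M"
    "cycle_edges us = (cycle_edges vs - {{x, y}}) \<union> path_edges (x # M @ [y])"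
proof -
  obtain B where B: "is_cycle_list E (y # B @ [x])" "set (y # B @ [x]) = set vs"
    "cycle_edges (y # B @ [x]) = cycle_edges vs" "length (y # B @ [x]) = length vs"
    using cycle_edge_split[OF assms(1,2)] by blast
  let ?us = "y # B @ x # M"
  have us: "cycle_edges ?us = path_edges (y # B @ [x]) \<union> path_edges (x # M @ [y])"
    using path_edges_append[of "y # B" x "M @ [y]"] by (simp add: cycle_edges_Cons)
  have "{x, y} \<notin> path_edges (y # B @ [x])"
    using closing_edge_notin_path_edges[of "y # B @ [x]"] B(1)
    by (simp add: is_cycle_list_iff insert_commute)
  then have "cycle_edges vs - {{x, y}} = path_edges (y # B @ [x])"
    using B(3) unfolding cycle_edges_Cons_snoc by blast
  then have us': "cycle_edges ?us = (cycle_edges vs - {{x, y}}) \<union> path_edges (x # M @ [y])"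
    using us by simp
  moreover have "cycle_edges vs \<subseteq> E" using assms(1) by (simp add: is_cycle_list_iff)
  ultimately have "cycle_edges ?us \<subseteq> E" using assms(5) by auto
  moreover have "distinct ?us" using B(1,2) assms(3,4) by (auto simp: is_cycle_list_iff)
  moreover have "length ?us \<ge> 3" using B(1) by (simp add: is_cycle_list_iff)
  ultimately have "is_cycle_list E ?us" by (simp add: is_cycle_list_iff)
  then show ?thesis using us' B(2,4) by (intro that[of ?us]) auto
qed

lemma cycle_edges_at_start:
  assumes "distinct (x # A)" "A \<noteq> []"
  shows "{e \<in> cycle_edges (x # A). x \<in> e} = {{x, hd A}, {x, last A}}"
proof -
  have "path_edges (x # A @ [x]) = {{x, hd A}} \<union> path_edges (A @ [x])"
    using assms(2) by (cases A) auto
  moreover have "path_edges (A @ [x]) = path_edges A \<union> {{last A, x}}"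
    using path_edges_snoc[OF assms(2)] by simp
  moreover have "x \<notin> e" if "e \<in> path_edges A" for e
    using path_edges_subset[OF that] assms(1) by auto
  ultimately show ?thesis by (auto simp: cycle_edges_Cons insert_commute)
qed

lemma card_cycle_edges_at:
  assumes "is_cycle_list E vs"
  shows "card {e \<in> cycle_edges vs. x \<in> e} \<le> 2"
proof (cases "x \<in> set vs")
  case True
  obtain A where A: "is_cycle_list E (x # A)" "cycle_edges (x # A) = cycle_edges vs"
    using cycle_start[OF assms True] by metis
  then have "distinct (x # A)" "A \<noteq> []" by (auto simp: is_cycle_list_iff)
  from cycle_edges_at_start[OF this] A(2) have "{e \<in> cycle_edges vs. x \<in> e} = {{x, hd A}, {x, last A}}"
    by simp
  then show ?thesis using card_insert_le_m1[of 2 "{{x, last A}}" "{x, hd A}"] by simp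
next
  case False
  have "vs \<noteq> []" using assms by (auto simp: is_cycle_list_iff)
  then have "e \<subseteq> set vs" if "e \<in> cycle_edges vs" for e
    using path_edges_subset[of e "vs @ [hd vs]"] that by (auto simp: cycle_edges_eq)
  then have "{e \<in> cycle_edges vs. x \<in> e} = {}" using False by blast
  then show ?thesis by (metis card.empty le0)
qed

text \<open>The cycle neighbours of \<open>u\<close> are the two ends of the path left after
  removing \<open>u\<close>; with at least three vertices on that path, its ends are not
  consecutive.\<close>

lemma no_triangle_in_cycle_edges:
  assumes "is_cycle_list E vs" "length vs \<ge> 4" "u \<noteq> v" "u \<noteq> x" "v \<noteq> x"
    "{u, v} \<in> cycle_edges vs" "{u, x} \<in> cycle_edges vs" "{v, x} \<in> cycle_edges vs"
  shows False
proof -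
  have "vs \<noteq> []" using assms(2) by auto
  then have "u \<in> set vs" using path_edges_subset[of "{u, v}" "vs @ [hd vs]"] assms(6) by (auto simp: cycle_edges_eq)
  then obtain A where A: "is_cycle_list E (u # A)" "cycle_edges (u # A) = cycle_edges vs" "length (u # A) = length vs"
    using cycle_start[OF assms(1)] by metis
  then have d: "distinct (u # A)" "A \<noteq> []" "distinct A" "length A \<ge> 3" using assms(2) by (auto simp: is_cycle_list_iff)
  have "{u, z} \<in> {{u, hd A}, {u, last A}}" if "{u, z} \<in> cycle_edges vs" for z
  proof -
    have "{u, z} \<in> {e \<in> cycle_edges (u # A). u \<in> e}" using that A(2) by simp
    then show ?thesis by (simp only: cycle_edges_at_start[OF d(1,2)])
  qed
  from this[OF assms(6)] this[OF assms(7)]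
  have "{u, v} \<in> {{u, hd A}, {u, last A}}" "{u, x} \<in> {{u, hd A}, {u, last A}}" .
  then have "{v, x} = {hd A, last A}" using assms(3-5) by (auto simp: doubleton_eq_iff)
  moreover have "{v, x} \<in> path_edges A"
  proof -
    have "path_edges (u # A @ [u]) = {{u, hd A}} \<union> path_edges (A @ [u])"
      using d(2) by (cases A) auto
    moreover have "path_edges (A @ [u]) = path_edges A \<union> {{last A, u}}"
      using path_edges_snoc[OF d(2)] by simp
    ultimately have "cycle_edges vs = {{u, hd A}, {last A, u}} \<union> path_edges A"
      using A(2) by (auto simp: cycle_edges_Cons)
    then show ?thesis using assms(3-5,8) by (auto simp: doubleton_eq_iff)
  qed
  ultimately show False using closing_edge_notin_path_edges[OF d(3,4)] by simp
qed

section \<open>Graphs without cut vertices\<close>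

text \<open>Having no cut vertex, phrased by splitting the edges. Since the two sides may also share
  no vertex at all, this includes connectedness up to isolated vertices.\<close>

definition inseparable :: "'a set set \<Rightarrow> bool" where
  "inseparable E \<longleftrightarrow> (\<forall>E1 E2 x. E1 \<union> E2 = E \<and> E1 \<inter> E2 = {} \<and> \<Union>E1 \<inter> \<Union>E2 \<subseteq> {x} \<longrightarrow> E1 = {} \<or> E2 = {})"

definition graph :: "'a set set \<Rightarrow> bool" where
  "graph E \<longleftrightarrow> finite E \<and> (\<forall>e\<in>E. card e = 2)"

lemma graph_subset: "graph E \<Longrightarrow> F \<subseteq> E \<Longrightarrow> graph F"
  unfolding graph_def by (meson finite_subset subsetD)

lemma graph_edge_at:
  assumes "graph E" "e \<in> E" "v \<in> e"
  obtains q where "e = {v, q}" "q \<noteq> v"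
proof -
  have "card e = 2" using assms by (simp add: graph_def)
  then obtain a b where "e = {a, b}" "a \<noteq> b" by (meson card_2_iff)
  then show ?thesis using that[of a] that[of b] assms(3) by (auto simp: insert_commute)
qed

lemma graph_edge_distinct: "graph E \<Longrightarrow> {x, y} \<in> E \<Longrightarrow> x \<noteq> y"
  by (auto simp: graph_def)

abbreviation walk_avoiding :: "'a set set \<Rightarrow> 'a set \<Rightarrow> 'a \<Rightarrow> 'a \<Rightarrow> bool" where
  "walk_avoiding E S \<equiv> (\<lambda>a b. {a, b} \<in> E \<and> b \<notin> S)\<^sup>*\<^sup>*"

lemma path_of_walk:
  assumes "walk_avoiding E S a b" "a \<notin> S"
  shows "\<exists>M. M \<noteq> [] \<and> hd M = a \<and> last M = b \<and> distinct M \<and> set M \<inter> S = {} \<and> path_edges M \<subseteq> E"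
  using assms
proof (induction rule: converse_rtranclp_induct)
  case base
  then show ?case by (intro exI[of _ "[b]"]) auto
next
  case (step y z)
  then obtain M where M: "M \<noteq> []" "hd M = z" "last M = b" "distinct M" "set M \<inter> S = {}" "path_edges M \<subseteq> E"
    by auto
  show ?case
  proof (cases "y \<in> set M")
    case True
    then obtain P Q where "M = P @ y # Q" by (meson split_list)
    then show ?thesis using M path_edges_append[of P y Q] by (intro exI[of _ "y # Q"]) auto
  next
    case False
    then show ?thesis using M step path_edges_Cons[of M y] by (intro exI[of _ "y # M"]) auto
  qed
qed

text \<open>Otherwise the edges touching \<open>D\<close>, the part reachable from \<open>e\<close>
  without entering \<open>d\<close> or \<open>S\<close>, would meet the remaining edges in
  \<open>d\<close> at most. The edge \<open>f\<close> inside \<open>S\<close> makes the other side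
  of this separation nonempty. The vertex \<open>d\<close> may lie in \<open>S\<close> or
  outside.\<close>

lemma inseparable_path_to:
  assumes "graph E" "inseparable E" "{d, e} \<in> E" "e \<notin> S" "f \<in> E" "f \<subseteq> S"
  obtains M t where "M \<noteq> []" "hd M = e" "distinct M" "set M \<inter> insert d S = {}" "path_edges M \<subseteq> E"
    "t \<in> S" "t \<noteq> d" "{last M, t} \<in> E"
proof -
  have "e \<noteq> d" using graph_edge_distinct[OF assms(1,3)] by simp
  define D where "D = {z. walk_avoiding E (insert d S) e z}"
  have "e \<in> D" by (simp add: D_def)
  have D_S: "z \<notin> insert d S" if "z \<in> D" for z
    using that assms(4) \<open>e \<noteq> d\<close> unfolding D_def by (auto elim: rtranclp.cases)
  have D_step: "q \<in> insert d (S \<union> D)" if "z \<in> D" "{z, q} \<in> E" for z q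
    using that unfolding D_def by (auto intro: rtranclp.rtrancl_into_rtrancl)
  have "\<exists>z\<in>D. \<exists>t\<in>S - {d}. {z, t} \<in> E"
  proof (rule ccontr)
    assume no: "\<not> ?thesis"
    define E1 where "E1 = {g \<in> E. g \<inter> D \<noteq> {}}"
    have E1: "g \<subseteq> insert d D" if "g \<in> E1" for g
    proof -
      obtain z where z: "g \<in> E" "z \<in> g" "z \<in> D" 
        using \<open>g \<in> E1\<close> by (auto simp: E1_def)
      obtain q where q: "g = {z, q}" using graph_edge_at[OF assms(1) z(1,2)] by blast
      then show ?thesis using z D_step[of z q] no by blast
    qed
    have "\<Union>E1 \<inter> \<Union>(E - E1) \<subseteq> {d}"
    proof
      fix z assume z: "z \<in> \<Union>E1 \<inter> \<Union>(E - E1)"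
      then have "z \<in> insert d D" using E1 by blast
      moreover have "z \<notin> D" using z by (auto simp: E1_def)
      ultimately show "z \<in> {d}" by simp
    qed
    moreover have "E1 \<union> (E - E1) = E" "E1 \<inter> (E - E1) = {}" by (auto simp: E1_def)
    ultimately have "E1 = {} \<or> E - E1 = {}" using assms(2) unfolding inseparable_def by blast
    moreover have "{d, e} \<in> E1" using assms(3) \<open>e \<in> D\<close> by (auto simp: E1_def)
    moreover have "f \<in> E - E1" using assms(5,6) D_S by (auto simp: E1_def)
    ultimately show False by blast
  qed
  then obtain z t where zt: "z \<in> D" "t \<in> S" "t \<noteq> d" "{z, t} \<in> E" by blast
  have "walk_avoiding E (insert d S) e z" using zt(1) by (simp add: D_def)
  then obtain M where "M \<noteq> []" "hd M = e" "last M = z" "distinct M" "set M \<inter> insert d S = {}" "path_edges M \<subseteq> E"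
    using path_of_walk[of E "insert d S" e z] assms(4) \<open>e \<noteq> d\<close> by auto
  then show ?thesis using that zt by metis
qed

lemma bipartition_path_parity:
  assumes "bipartition f E" "M \<noteq> []" "path_edges M \<subseteq> E"
  shows "f (hd M) = f (last M) \<longleftrightarrow> odd (length M)"
  using assms(2,3)
proof (induction M rule: path_edges.induct)
  case (1 x y zs)
  then have "{x, y} \<in> E" by simp
  then have "f x \<noteq> f y" using assms(1) unfolding bipartition_def by (metis doubleton_eq_iff)
  then show ?case using 1 by auto
qed auto

text \<open>When a new edge \<open>{x, y}\<close> joins two vertices of the same class, a path
  between them would have an odd number of vertices and close to an odd cycle. So \<open>x\<close>
  is outside the component of \<open>y\<close>, and the classes can be exchanged on that
  component.\<close>

lemma bipartition_if_no_odd_cycle: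
  assumes "graph E" "\<And>vs. is_cycle_list E vs \<Longrightarrow> even (length vs)"
  shows "\<exists>f. bipartition f E"
proof -
  have "finite E" using assms(1) by (simp add: graph_def)
  then show ?thesis
    using assms
  proof (induction E rule: finite_induct)
    case empty
    then show ?case by (simp add: bipartition_def)
  next
    case (insert e E)
    have gr: "graph E" using insert.prems(1) graph_subset by blast
    have "even (length vs)" if "is_cycle_list E vs" for vs
      using that insert.prems(2)[of vs] by (auto simp: is_cycle_list_iff)
    then obtain f where f: "bipartition f E" using insert.IH gr by blast
    have "card e = 2" using insert.prems(1) by (simp add: graph_def)
    then obtain x y where e: "e = {x, y}" "x \<noteq> y" by (meson card_2_iff)
    have extend: "\<exists>g. bipartition g (insert e E)" if "bipartition g E" "g x \<noteq> g y" for g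
      using that e unfolding bipartition_def by (metis insertE insert_commute)
    show ?case
    proof (cases "f x = f y")
      case True
      define D where "D = {z. walk_avoiding E {} y z}"
      have "x \<notin> D"
      proof
        assume "x \<in> D"
        then obtain M where M: "M \<noteq> []" "hd M = y" "last M = x" "distinct M" "path_edges M \<subseteq> E"
          using path_of_walk[of E "{}" y x] by (auto simp: D_def)
        have odd: "odd (length M)" using bipartition_path_parity[OF f M(1,5)] M(2,3) True by simp
        have "length M \<noteq> 1" using M(2,3) e(2) by (auto simp: length_Suc_conv)
        then have "length M \<ge> 3" using odd M(1) by presburger
        moreover have "cycle_edges M \<subseteq> insert e E"
          using M e(1) path_edges_snoc[OF M(1), of y] by (auto simp: cycle_edges_eq)
        ultimately have "is_cycle_list (insert e E) M" using M(4) by (simp add: is_cycle_list_iff)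
        then show False using insert.prems(2) odd by blast
      qed
      have "y \<in> D" by (simp add: D_def)
      have step: "p \<in> D \<longleftrightarrow> q \<in> D" if "{p, q} \<in> E" for p q
      proof -
        have "{q, p} \<in> E" using that by (simp add: insert_commute)
        then show ?thesis using that unfolding D_def by (auto intro: rtranclp.rtrancl_into_rtrancl)
      qed
      define g where "g z = (if z \<in> D then \<not> f z else f z)" for z
      have "bipartition g E"
        unfolding bipartition_def
      proof
        fix e' assume "e' \<in> E"
        then obtain p q where pq: "e' = {p, q}" "f p" "\<not> f q" using f by (auto simp: bipartition_def)
        have "p \<in> D \<longleftrightarrow> q \<in> D" using step pq(1) \<open>e' \<in> E\<close> by blast
        then show "\<exists>x y. e' = {x, y} \<and> g x \<and> \<not> g y"
          using pq by (cases "p \<in> D") (auto simp: g_def insert_commute)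
      qed
      then show ?thesis using extend[of g] \<open>x \<notin> D\<close> \<open>y \<in> D\<close> True by (simp add: g_def)
    qed (use extend f in blast)
  qed
qed

text \<open>\<open>M\<close> lists the inner vertices, so there are \<open>length M + 1\<close>
  edges, and an ear is even when \<open>length M\<close> is odd. Chords are not ears.\<close>

definition ear :: "'a set set \<Rightarrow> 'a set \<Rightarrow> 'a \<Rightarrow> 'a list \<Rightarrow> 'a \<Rightarrow> bool" where
  "ear E S x M t \<longleftrightarrow> x \<in> S \<and> t \<in> S \<and> x \<noteq> t \<and> M \<noteq> [] \<and> distinct M \<and> set M \<inter> S = {} \<and>
    path_edges (x # M @ [t]) \<subseteq> E"

definition attached :: "'a set set \<Rightarrow> 'a set \<Rightarrow> 'a \<Rightarrow> bool" where
  "attached E S x \<longleftrightarrow> x \<in> S \<and> (\<exists>y. y \<notin> S \<and> {x, y} \<in> E)"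

lemma path_edges_ends:
  "M \<noteq> [] \<Longrightarrow> path_edges (x # M @ [t]) = path_edges M \<union> {{x, hd M}, {last M, t}}"
  using path_edges_Cons[of "M @ [t]" x] path_edges_snoc[of M t] by (cases M) auto

lemma ear_sym: "ear E S x M t \<Longrightarrow> ear E S t (rev M) x"
  using path_edges_rev[of "x # M @ [t]"] by (auto simp: ear_def)

lemma attached_ear:
  assumes "ear E S x M t"
  shows "attached E S x" "attached E S t"
proof -
  have "{x, hd M} \<in> E" "{last M, t} \<in> E" "hd M \<notin> S" "last M \<notin> S"
    using assms path_edges_ends[of M x t] hd_in_set[of M] last_in_set[of M]
    unfolding ear_def by blast+
  then show "attached E S x" "attached E S t" using assms by (auto simp: attached_def ear_def insert_commute)
qed

text \<open>\<open>M\<close> is followed up to its first vertex on \<open>N\<close>, then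
  \<open>N\<close> is followed backwards; taking the first such vertex keeps the result
  simple.\<close>

lemma crossing_paths:
  assumes "set M \<inter> set N \<noteq> {}" "distinct M" "distinct N"
  shows "\<exists>P. P \<noteq> [] \<and> hd P = hd M \<and> last P = hd N \<and> distinct P \<and> set P \<subseteq> set M \<union> set N \<and>
    path_edges P \<subseteq> path_edges M \<union> path_edges N"
proof -
  have "\<exists>z\<in>set M. z \<in> set N" using assms(1) by blast
  from split_list_first_prop[OF this] obtain M1 z M2
    where M: "M = M1 @ z # M2" "z \<in> set N" "\<forall>y\<in>set M1. y \<notin> set N"
    by blast
  then obtain N1 N2 where N: "N = N1 @ z # N2" by (meson split_list)
  let ?P = "M1 @ z # rev N1"
  have "path_edges ?P = path_edges (M1 @ [z]) \<union> path_edges (N1 @ [z])"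
    using path_edges_append[of M1 z "rev N1"] path_edges_rev[of "N1 @ [z]"] by simp
  also have "\<dots> \<subseteq> path_edges M \<union> path_edges N"
    using M(1) N path_edges_append[of M1 z M2] path_edges_append[of N1 z N2] by auto
  finally have "path_edges ?P \<subseteq> path_edges M \<union> path_edges N" .
  moreover have "distinct ?P" using M N assms by auto
  moreover have "hd ?P = hd M" using M(1) by (simp add: hd_append)
  moreover have "last ?P = hd N" using N by (simp add: hd_append last_rev)
  moreover have "set ?P \<subseteq> set M \<union> set N" using M(1) N by auto
  ultimately show ?thesis by blast
qed

lemma ear_crossing:
  assumes "ear E S u M v" "ear E S x N y" "set M \<inter> set N \<noteq> {}" "u \<noteq> x"
  shows "\<exists>P. ear E S u P x"
proof -
  obtain P where P: "P \<noteq> []" "hd P = hd M" "last P = hd N" "distinct P" "set P \<subseteq> set M \<union> set N"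
    "path_edges P \<subseteq> path_edges M \<union> path_edges N"
    using crossing_paths[of M N] assms by (auto simp: ear_def)
  have "path_edges (u # M @ [v]) = path_edges M \<union> {{u, hd M}, {last M, v}}"
    "path_edges (x # N @ [y]) = path_edges N \<union> {{x, hd N}, {last N, y}}"
    using assms(1,2) by (simp_all add: ear_def path_edges_ends)
  then have "path_edges (u # P @ [x]) \<subseteq> E"
    using assms(1,2) P by (auto simp: ear_def path_edges_ends insert_commute dest: subsetD)
  moreover have "set P \<inter> S = {}" using P(5) assms(1,2) by (auto simp: ear_def)
  ultimately show ?thesis using assms P by (intro exI[of _ P]) (auto simp: ear_def)
qed

lemma edge_of_cycle:
  assumes "is_cycle_list E vs"
  obtains u v where "u \<noteq> v" "{u, v} \<in> cycle_edges vs" "{u, v} \<in> E" "u \<in> set vs" "v \<in> set vs"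
proof -
  obtain u v zs where vs: "vs = u # v # zs"
    using assms by (auto simp: is_cycle_list_iff Suc_le_length_iff numeral_3_eq_3)
  then have "{u, v} \<in> cycle_edges vs" by (simp add: cycle_edges_Cons)
  then show ?thesis using that assms vs by (auto simp: is_cycle_list_iff)
qed

lemma attached_obtain_ear:
  assumes "graph E" "inseparable E" "is_cycle_list E vs" "x \<in> set vs" "e \<notin> set vs" "{x, e} \<in> E"
  obtains M t where "ear E (set vs) x M t" "hd M = e"
proof -
  obtain u v where uv: "{u, v} \<in> E" "{u, v} \<subseteq> set vs"
    using edge_of_cycle[OF assms(3)] by (metis empty_subsetI insert_subset)
  obtain M t where M: "M \<noteq> []" "hd M = e" "distinct M" "set M \<inter> insert x (set vs) = {}" "path_edges M \<subseteq> E"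
    "t \<in> set vs" "t \<noteq> x" "{last M, t} \<in> E"
    using inseparable_path_to[OF assms(1,2,6,5) uv] by blast
  then have "ear E (set vs) x M t"
    using assms(4,6) by (auto simp: ear_def path_edges_ends)
  then show ?thesis using that M(2) by blast
qed

section \<open>Where ears of an odd cycle attach, and the resulting structure\<close>

lemma deg_unattached:
  assumes "graph E" "odd_cycles_share_at_most_one E" "is_cycle_list E vs" "odd (length vs)"
    "x \<in> set vs" "\<not> attached E (set vs) x"
  shows "{e \<in> E. x \<in> e} \<subseteq> cycle_edges vs" "deg E x \<le> 2"
proof -
  \<comment> \<open>No edge at \<open>x\<close> leaves the cycle, and an odd cycle has no
    chords.\<close>
  have sub: "e \<in> cycle_edges vs" if e: "e \<in> E" "x \<in> e" for e
  proof -
    obtain q where q: "e = {x, q}" "q \<noteq> x" using graph_edge_at[OF assms(1) e] by blast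
    then have "q \<in> set vs" using assms(5,6) e by (auto simp: attached_def)
    then show ?thesis
      using ear_of_odd_cycle[OF assms(2-5), of q "[]"] q e by auto
  qed
  then show "{e \<in> E. x \<in> e} \<subseteq> cycle_edges vs" by blast
  then have "card {e \<in> E. x \<in> e} \<le> card {e \<in> cycle_edges vs. x \<in> e}"
    using card_cycle_edges[of vs] assms(3) by (intro card_mono) (auto simp: is_cycle_list_iff)
  then show "deg E x \<le> 2" using card_cycle_edges_at[OF assms(3), of x] by (simp add: deg_def)
qed

text \<open>If ears sit on two different edges of the cycle, replacing both edges gives
  another odd cycle that shares all remaining edges.\<close>
lemma ears_on_single_edge:
  assumes "graph E" "odd_cycles_share_at_most_one E" "inseparable E"
    "is_cycle_list E vs" "odd (length vs)" "length vs \<ge> 5"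
  shows "\<exists>u v. u \<noteq> v \<and> {u, v} \<in> cycle_edges vs \<and> (\<forall>x. attached E (set vs) x \<longrightarrow> x \<in> {u, v})"
proof (cases "\<exists>u. attached E (set vs) u")
  case False
  then show ?thesis using edge_of_cycle[OF assms(4)] by metis
next
  case True
  let ?S = "set vs"
  have ear_edge: "{x, y} \<in> cycle_edges vs \<and> odd (length M)" if "ear E ?S x M y" for x y M
    using ear_of_odd_cycle[OF assms(2,4,5), of x y M] that by (auto simp: ear_def)
  have obtain_ear: "\<exists>M t. ear E ?S x M t" if "attached E ?S x" for x
    using that attached_obtain_ear[OF assms(1,3,4)] unfolding attached_def by metis
  obtain u M v where M: "ear E ?S u M v" using True obtain_ear by blast
  then have uv: "u \<noteq> v" "{u, v} \<in> cycle_edges vs" "odd (length M)" using ear_edge by (auto simp: ear_def)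
  have "x \<in> {u, v}" if "attached E ?S x" for x
  proof (rule ccontr)
    assume x: "x \<notin> {u, v}"
    obtain N y where N: "ear E ?S x N y" using obtain_ear[OF \<open>attached E ?S x\<close>] by blast
    then have xy: "x \<noteq> y" "{x, y} \<in> cycle_edges vs" "odd (length N)" using ear_edge by (auto simp: ear_def)
    show False
    proof (cases "set M \<inter> set N = {}")
      \<comment> \<open>Ears that meet recombine to ears from \<open>u\<close> and from
        \<open>v\<close> to \<open>x\<close>. Each spans a cycle edge, which would put the triangle
        \<open>u\<close>, \<open>v\<close>, \<open>x\<close> into a cycle of length at least
        5.\<close>
      case False
      have "\<exists>P. ear E ?S u P x" using ear_crossing[OF M N False] x by blast
      moreover have "\<exists>P. ear E ?S v P x" using ear_crossing[OF ear_sym[OF M] N] False x by auto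
      ultimately have "{u, x} \<in> cycle_edges vs" "{v, x} \<in> cycle_edges vs" using ear_edge by blast+
      then show False
        using no_triangle_in_cycle_edges[OF assms(4) _ uv(1) _ _ uv(2), of x] x assms(6) by simp blast
    next
      case True
      obtain us where us: "is_cycle_list E us" "length us = length vs + length M" "set us = ?S \<union> set M"
        "cycle_edges us = (cycle_edges vs - {{u, v}}) \<union> path_edges (u # M @ [v])"
        using cycle_replace_edge[OF assms(4) uv(2), of M] M by (auto simp: ear_def)
      have ne: "{x, y} \<noteq> {u, v}" using x by (auto simp: doubleton_eq_iff)
      then have "{x, y} \<in> cycle_edges us" using us(4) xy(2) by blast
      moreover have "set N \<inter> set us = {}" using N us(3) True by (auto simp: ear_def)
      ultimately obtain ws where ws: "is_cycle_list E ws" "length ws = length us + length N"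
        "cycle_edges ws = (cycle_edges us - {{x, y}}) \<union> path_edges (x # N @ [y])"
        using cycle_replace_edge[OF us(1), of x y N] N unfolding ear_def by metis
      have odd: "odd (length ws)" using ws(2) us(2) uv(3) xy(3) assms(5) by simp
      \<comment> \<open>At least \<open>5 - 2 = 3\<close> edges survive both replacements, so the
        new odd cycle has two edges in common with the old one and must equal it. But it contains
        the edge from \<open>u\<close> to \<open>hd M\<close>, which leaves the old cycle.\<close>
      let ?R = "cycle_edges vs - {{u, v}, {x, y}}"
      have fin: "finite (cycle_edges vs)" "card (cycle_edges vs) = length vs"
        using card_cycle_edges[of vs] assms(4) by (auto simp: is_cycle_list_iff)
      have "card {{u, v}, {x, y}} \<le> 2" by (simp add: card_insert_if)
      moreover have "card (cycle_edges vs) - card {{u, v}, {x, y}} \<le> card ?R"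
        by (rule diff_card_le_card_Diff) simp
      ultimately have "card ?R \<ge> 3" using fin(2) assms(6) by linarith
      then have "\<not> card ?R \<le> Suc 0" by simp
      then obtain e1 e2 where e: "e1 \<in> ?R" "e2 \<in> ?R" "e1 \<noteq> e2"
        using fin(1) card_le_Suc0_iff_eq[of ?R] by blast
      have "?R \<subseteq> cycle_edges ws" using ws(3) us(4) by blast
      then have eq: "cycle_edges vs = cycle_edges ws"
        using odd_cycles_eqI[OF assms(2,4,5) ws(1) odd e(3)] e by blast
      have hd: "hd M \<notin> ?S" "M \<noteq> []" using M hd_in_set[of M] unfolding ear_def by blast+
      have "{u, hd M} \<in> cycle_edges us" unfolding us(4) path_edges_ends[OF hd(2)] by simp
      moreover have "{u, hd M} \<noteq> {x, y}" using hd(1) N by (auto simp: ear_def doubleton_eq_iff)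
      ultimately have "{u, hd M} \<in> cycle_edges vs" using ws(3) eq by blast
      then have "{u, hd M} \<subseteq> ?S" using path_edges_subset[of "{u, hd M}" "vs @ [hd vs]"] assms(6)
        by (cases vs) (auto simp: cycle_edges_Cons)
      then show False using hd(1) by blast
    qed
  qed
  then show ?thesis using uv by blast
qed

text \<open>Cycle vertices other than \<open>u\<close> and \<open>v\<close> have degree 2, so an
  edge between two of them has degree sum at most 4 and must contain \<open>w\<close>. The path
  \<open>B\<close> of these vertices has at least three vertices and all its edges contain
  \<open>w\<close>: it has exactly three, with \<open>w\<close> in the middle.\<close>

lemma long_odd_cycle_has_length_5:
  assumes "graph E" "odd_cycles_share_at_most_one E" "inseparable E"
    "is_cycle_list E vs" "odd (length vs)" "length vs \<ge> 5"
    and heavy: "\<forall>a b. {a, b} \<in> E \<longrightarrow> w \<notin> {a, b} \<longrightarrow> deg E a + deg E b \<ge> 5"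
  shows "\<exists>u a b v. is_cycle_list E [u, a, w, b, v] \<and> set [u, a, w, b, v] = set vs \<and>
    cycle_edges [u, a, w, b, v] = cycle_edges vs \<and> (\<forall>x. attached E (set vs) x \<longrightarrow> x \<in> {u, v})"
proof -
  obtain u v where uv: "{v, u} \<in> cycle_edges vs" "\<forall>x. attached E (set vs) x \<longrightarrow> x \<in> {u, v}"
    using ears_on_single_edge[OF assms(1-6)] by (metis insert_commute)
  obtain B where B: "is_cycle_list E (u # B @ [v])" "set (u # B @ [v]) = set vs"
    "cycle_edges (u # B @ [v]) = cycle_edges vs" "length (u # B @ [v]) = length vs"
    using cycle_edge_split[OF assms(4) uv(1)] by blast
  have dist: "distinct (u # B @ [v])" using B(1) by (simp add: is_cycle_list_iff)
  have deg2: "deg E x \<le> 2" if "x \<in> set B" for x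
    using deg_unattached(2)[OF assms(1,2,4,5), of x] uv(2) that dist B(2) by force
  have light: "w \<in> {a, b}" if "{a, b} \<in> path_edges B" "a \<in> set B" "b \<in> set B" for a b
  proof (rule ccontr)
    assume w: "w \<notin> {a, b}"
    have "B \<noteq> []" using that(2) by auto
    then have "path_edges B \<subseteq> cycle_edges (u # B @ [v])"
      by (auto simp: cycle_edges_Cons_snoc path_edges_ends)
    then have "{a, b} \<in> E" using that(1) B(1) by (auto simp: is_cycle_list_iff)
    then have "deg E a + deg E b \<ge> 5" using heavy w by blast
    then show False using deg2[OF that(2)] deg2[OF that(3)] by linarith
  qed
  have "length B \<ge> 3" using B(4) assms(6) by simp
  then obtain a c b B' where B': "B = a # c # b # B'" by (auto simp: Suc_le_length_iff numeral_3_eq_3)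
  have "w \<in> {a, c}" "w \<in> {c, b}" using light B' by auto
  then have "w = c" using dist B' by auto
  have "B' = []"
  proof (rule ccontr)
    assume "B' \<noteq> []"
    then obtain d B'' where "B' = d # B''" by (meson neq_Nil_conv)
    then have "w \<in> {b, d}" using light[of b d] B' by auto
    then show False using \<open>w = c\<close> dist B' \<open>B' = d # B''\<close> by auto
  qed
  then have "u # B @ [v] = [u, a, w, b, v]" using B' \<open>w = c\<close> by simp
  then show ?thesis using B uv(2) by metis
qed

text \<open>A vertex next to the cycle is the only inner vertex of an ear, which gives it two
  neighbours on the cycle. It has none outside, since continuing there would produce a longer ear;
  so edges that miss the cycle would be disconnected from the others.\<close>

lemma short_ears_cover:
  assumes "graph E" "inseparable E" "is_cycle_list E vs"
    and short: "\<forall>x M t. ear E (set vs) x M t \<longrightarrow> length M = 1"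
  shows "\<And>e. e \<in> E \<Longrightarrow> e \<inter> set vs \<noteq> {}"
    and "\<And>z e. e \<in> E \<Longrightarrow> z \<in> e \<Longrightarrow> z \<notin> set vs \<Longrightarrow>
      \<exists>s\<in>set vs. \<exists>t\<in>set vs. s \<noteq> t \<and> {z, s} \<in> E \<and> {z, t} \<in> E"
proof -
  let ?S = "set vs"
  obtain u v where uv: "{u, v} \<in> E" "{u, v} \<subseteq> ?S"
    using edge_of_cycle[OF assms(3)] by (metis empty_subsetI insert_subset)
  have two: "\<exists>t\<in>?S. s \<noteq> t \<and> {z, t} \<in> E" if "z \<notin> ?S" "s \<in> ?S" "{z, s} \<in> E" for z s
  proof -
    have "{s, z} \<in> E" using that(3) by (simp add: insert_commute)
    then obtain M t where M: "ear E ?S s M t" "hd M = z"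
      using attached_obtain_ear[OF assms(1-3) \<open>s \<in> ?S\<close> \<open>z \<notin> ?S\<close>] by blast
    then have "length M = 1" using short by blast
    then have "M = [z]" using M(2) by (cases M) auto
    then show ?thesis using M(1) by (auto simp: ear_def)
  qed
  \<comment> \<open>A path from \<open>e\<close> returns to the cycle at \<open>t\<close> while
    avoiding \<open>d\<close>. One of the two cycle neighbours of \<open>d\<close> differs from
    \<open>t\<close>; starting there gives an ear through \<open>d\<close> and
    \<open>e\<close>.\<close>
  have nbr: "e \<in> ?S" if d: "d \<notin> ?S" "s \<in> ?S" "{d, s} \<in> E" "{d, e} \<in> E" for d s e
  proof (rule ccontr)
    assume e: "e \<notin> ?S"
    obtain s' where s': "s' \<in> ?S" "s \<noteq> s'" "{d, s'} \<in> E" using two[OF d(1-3)] by blast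
    obtain M t where M: "M \<noteq> []" "distinct M" "set M \<inter> insert d ?S = {}" "hd M = e"
      "path_edges M \<subseteq> E" "t \<in> ?S" "t \<noteq> d" "{last M, t} \<in> E"
      using inseparable_path_to[OF assms(1,2) d(4) e uv] by blast
    obtain r where r: "r \<in> ?S" "r \<noteq> t" "{r, d} \<in> E"
      using s' d(2,3) by (cases "s = t") (auto simp: insert_commute)
    have "path_edges (r # (d # M) @ [t]) \<subseteq> E"
      using M r(3) d(4) path_edges_ends[of M d t] by simp
    then have "ear E ?S r (d # M) t" using M r d(1) by (auto simp: ear_def)
    then have "length (d # M) = 1" using short by blast
    then show False using M(1) by simp
  qed
  have meets: "e \<inter> ?S \<noteq> {}" if "e \<in> E" for e
  proof (rule ccontr)
    assume "\<not> e \<inter> ?S \<noteq> {}"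
    define E1 where "E1 = {e \<in> E. e \<inter> ?S \<noteq> {}}"
    have "\<Union>E1 \<inter> \<Union>(E - E1) = {}"
    proof (rule ccontr)
      assume "\<Union>E1 \<inter> \<Union>(E - E1) \<noteq> {}"
      then obtain z f1 f2 where z: "z \<in> f1" "z \<in> f2" "f1 \<in> E" "f1 \<inter> ?S \<noteq> {}" "f2 \<in> E" "f2 \<inter> ?S = {}"
        by (auto simp: E1_def)
      obtain p q where pq: "f1 = {z, p}" "f2 = {z, q}"
        using graph_edge_at[OF assms(1) z(3,1)] graph_edge_at[OF assms(1) z(5,2)] by metis
      then show False using nbr[of z p q] z by auto
    qed
    moreover have "E1 \<union> (E - E1) = E" "E1 \<inter> (E - E1) = {}" by (auto simp: E1_def)
    ultimately have "E1 = {} \<or> E - E1 = {}"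
      using assms(2) unfolding inseparable_def by blast
    moreover have "{u, v} \<in> E1" using uv by (auto simp: E1_def)
    moreover have "e \<in> E - E1" using that \<open>\<not> e \<inter> ?S \<noteq> {}\<close> by (auto simp: E1_def)
    ultimately show False by blast
  qed
  then show "\<And>e. e \<in> E \<Longrightarrow> e \<inter> ?S \<noteq> {}" by blast
  show "\<exists>s\<in>?S. \<exists>t\<in>?S. s \<noteq> t \<and> {z, s} \<in> E \<and> {z, t} \<in> E" if z: "e \<in> E" "z \<in> e" "z \<notin> ?S" for z e
  proof -
    obtain q where q: "e = {z, q}" using graph_edge_at[OF assms(1) z(1,2)] by blast
    then have "q \<in> ?S" using meets[OF z(1)] z(3) by auto
    then show ?thesis using two[of z q] q z by blast
  qed
qed

lemma close_ear:
  assumes "ear E S x M t" "{x, t} \<in> E"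
  shows "is_cycle_list E (x # M @ [t])"
proof -
  have "cycle_edges (x # M @ [t]) \<subseteq> E"
    using assms by (auto simp: cycle_edges_Cons_snoc ear_def insert_commute)
  moreover have "length M \<ge> 1" using assms(1) by (cases M) (auto simp: ear_def)
  ultimately show ?thesis using assms(1) by (auto simp: ear_def is_cycle_list_iff)
qed

text \<open>All ears join \<open>u\<close> and \<open>v\<close>. An ear with three or more inner
  vertices would close with \<open>{u, v}\<close> to another odd cycle of length at least 5, which
  would again contain the root; but \<open>w\<close> lies inside the long arc of the first cycle. So
  the graph is \<open>{u, v}\<close>, the path \<open>u a w b v\<close> and paths with two edges
  from \<open>u\<close> to \<open>v\<close>.\<close>

lemma structure_long_odd_cycle:
  assumes gr: "graph E" and share: "odd_cycles_share_at_most_one E" and insep: "inseparable E"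
    and cyc: "is_cycle_list E vs" "odd (length vs)" "length vs \<ge> 5"
    and heavy: "\<forall>a b. {a, b} \<in> E \<longrightarrow> w \<notin> {a, b} \<longrightarrow> deg E a + deg E b \<ge> 5"
  shows "\<exists>u v. {u, v} \<in> E \<and> (\<exists>f. bipartition f (E - {{u, v}})) \<and>
    (\<forall>z. z \<notin> {u, v} \<longrightarrow> deg E z \<le> 2) \<and> \<not> ({u, w} \<in> E \<and> {v, w} \<in> E)"
proof -
  let ?S = "set vs"
  obtain u a b v where C: "is_cycle_list E [u, a, w, b, v]" "set [u, a, w, b, v] = ?S"
    "cycle_edges [u, a, w, b, v] = cycle_edges vs" "\<forall>x. attached E ?S x \<longrightarrow> x \<in> {u, v}"
    using long_odd_cycle_has_length_5[OF gr share insep cyc heavy] by (elim exE conjE) (rule that)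
  have S: "?S = {u, a, w, b, v}" using C(2) by simp
  have dist: "distinct [u, a, w, b, v]" using C(1) by (simp add: is_cycle_list_iff)
  have edges: "cycle_edges vs = {{u, a}, {a, w}, {w, b}, {b, v}, {v, u}}"
    unfolding C(3)[symmetric] by (simp add: cycle_edges_Cons)
  have sub: "cycle_edges vs \<subseteq> E" using cyc(1) by (simp add: is_cycle_list_iff)
  have ear: "{x, t} \<in> cycle_edges vs \<and> odd (length M)" if "ear E ?S x M t" for x M t
    using ear_of_odd_cycle[OF share cyc(1,2), of x t M] that by (auto simp: ear_def)
  have short: "\<forall>x M t. ear E ?S x M t \<longrightarrow> length M = 1"
  proof (intro allI impI, rule ccontr)
    fix x M t assume M: "ear E ?S x M t" and "length M \<noteq> 1"
    have "odd (length M)" using ear[OF M] by blast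
    then have "length M \<ge> 3" using \<open>length M \<noteq> 1\<close> by presburger
    then have "length (x # M @ [t]) \<ge> 5" "odd (length (x # M @ [t]))" using \<open>odd (length M)\<close> by auto
    moreover have "is_cycle_list E (x # M @ [t])" using close_ear[OF M] ear[OF M] sub by blast
    ultimately obtain u' a' b' v' where "set [u', a', w, b', v'] = set (x # M @ [t])"
      using long_odd_cycle_has_length_5[OF gr share insep _ _ _ heavy] by metis
    then have "w \<in> set (x # M @ [t])" by auto
    moreover have "w \<notin> set M" using M S by (auto simp: ear_def)
    moreover have "x \<in> {u, v}" "t \<in> {u, v}" using attached_ear[OF M] C(4) by blast+
    ultimately show False using dist by auto
  qed
  have E_cases: "e \<in> cycle_edges vs \<or> (\<exists>s q. e = {s, q} \<and> s \<in> {u, v} \<and> q \<notin> ?S)" if "e \<in> E" for e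
  proof -
    obtain s where s: "s \<in> e" "s \<in> ?S" using short_ears_cover(1)[OF gr insep cyc(1) short \<open>e \<in> E\<close>] by blast
    obtain q where q: "e = {s, q}" "q \<noteq> s" using graph_edge_at[OF gr \<open>e \<in> E\<close> s(1)] by blast
    show ?thesis
    proof (cases "q \<in> ?S")
      case True
      then show ?thesis using ear_of_odd_cycle[OF share cyc(1,2) s(2), of q "[]"] q that by auto
    next
      case False
      then have "attached E ?S s" using s q that by (auto simp: attached_def)
      then show ?thesis using C(4) q False by blast
    qed
  qed
  \<comment> \<open>The root joins the class of \<open>u\<close> and \<open>v\<close>: it is the
    middle of the only path with four edges, whereas the middle vertices of the short paths form the
    other class together with \<open>a\<close> and \<open>b\<close>.\<close>
  have "bipartition (\<lambda>z. z \<in> {u, v, w}) (E - {{u, v}})"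
    unfolding bipartition_def
  proof
    fix e assume e: "e \<in> E - {{u, v}}"
    then consider "e \<in> cycle_edges vs" | s q where "e = {s, q}" "s \<in> {u, v}" "q \<notin> ?S"
      using E_cases by blast
    then show "\<exists>x y. e = {x, y} \<and> x \<in> {u, v, w} \<and> y \<notin> {u, v, w}"
    proof cases
      case 1
      then have "e \<in> {{u, a}, {w, a}, {w, b}, {v, b}}" using edges e by (auto simp: insert_commute)
      then show ?thesis using dist by auto
    next
      case 2
      then have "s \<in> {u, v, w}" "q \<notin> {u, v, w}" using S by auto
      then show ?thesis using 2(1) by blast
    qed
  qed
  moreover have "deg E z \<le> 2" if z: "z \<notin> {u, v}" for z
  proof (cases "z \<in> ?S")
    case True
    then show ?thesis using deg_unattached(2)[OF gr share cyc(1,2)] C(4) z by blast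
  next
    case False
    have "e \<in> {{u, z}, {v, z}}" if e: "e \<in> E" "z \<in> e" for e
    proof -
      have "e \<notin> cycle_edges vs" using edges e(2) False S by auto
      then obtain s q where "e = {s, q}" "s \<in> {u, v}" "q \<notin> ?S" using E_cases[OF e(1)] by blast
      then show ?thesis using e(2) z by auto
    qed
    then have "card {e \<in> E. z \<in> e} \<le> card {{u, z}, {v, z}}" by (intro card_mono) auto
    also have "\<dots> \<le> 2" by (simp add: card_insert_if)
    finally show ?thesis by (simp add: deg_def)
  qed
  moreover have "\<not> {u, w} \<in> E"
  proof
    assume "{u, w} \<in> E"
    then consider "{u, w} \<in> cycle_edges vs" | s q where "{u, w} = {s, q}" "s \<in> {u, v}" "q \<notin> ?S"
      using E_cases by blast
    then show False
    proof cases
      case 1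
      then show ?thesis using edges dist by (auto simp: doubleton_eq_iff)
    next
      case 2
      then have "q \<in> {u, w}" by blast
      then show ?thesis using 2(3) S by auto
    qed
  qed
  moreover have "{u, v} \<in> E" using edges sub by (auto simp: insert_commute)
  ultimately show ?thesis by blast
qed

text \<open>An ear has an odd number of inner vertices and closes to an odd cycle of length below 5,
  hence has one inner vertex. Every vertex off the triangle therefore sees two or three of its
  vertices. Any combination other than the two listed contains a cycle of length 5.\<close>

lemma structure_triangles:
  assumes gr: "graph E" and share: "odd_cycles_share_at_most_one E" and insep: "inseparable E"
    and cyc: "is_cycle_list E vs" "odd (length vs)"
    and tri: "\<forall>us. is_cycle_list E us \<longrightarrow> odd (length us) \<longrightarrow> length us < 5"
  shows "(\<exists>u v Y. u \<noteq> v \<and> u \<notin> Y \<and> v \<notin> Y \<and> E = {{u, v}} \<union> (\<lambda>y. {u, y}) ` Y \<union> (\<lambda>y. {v, y}) ` Y) \<or>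
    (\<exists>a b c d. distinct [a, b, c, d] \<and> E = {{a, b}, {a, c}, {a, d}, {b, c}, {b, d}, {c, d}})"
proof -
  let ?S = "set vs"
  have "length vs \<ge> 3" "length vs < 5" using cyc tri by (auto simp: is_cycle_list_iff)
  then have "length vs = 3" using cyc(2) by presburger
  then obtain x1 x2 x3 where vs: "vs = [x1, x2, x3]"
    by (auto simp: length_Suc_conv numeral_3_eq_3)
  have dist: "distinct [x1, x2, x3]" using cyc(1) vs by (simp add: is_cycle_list_iff)
  have edges: "cycle_edges vs = {{x1, x2}, {x2, x3}, {x3, x1}}" using vs by (simp add: cycle_edges_Cons)
  have sub: "cycle_edges vs \<subseteq> E" using cyc(1) by (simp add: is_cycle_list_iff)
  have tri_edges: "{x1, x2} \<in> E" "{x2, x3} \<in> E" "{x3, x1} \<in> E" using edges sub by auto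
  then have "{x2, x1} \<in> E" "{x3, x2} \<in> E" "{x1, x3} \<in> E" by (simp_all add: insert_commute)
  then have inS: "{p, q} \<in> E" if "p \<in> ?S" "q \<in> ?S" "p \<noteq> q" for p q
    using that vs tri_edges by auto
  have short: "\<forall>x M t. ear E ?S x M t \<longrightarrow> length M = 1"
  proof (intro allI impI)
    fix x M t assume M: "ear E ?S x M t"
    have "{x, t} \<in> cycle_edges vs \<and> odd (length M)"
      using ear_of_odd_cycle[OF share cyc(1,2), of x t M] M by (auto simp: ear_def)
    then have "is_cycle_list E (x # M @ [t])" "odd (length (x # M @ [t]))" "odd (length M)"
      using close_ear[OF M] sub by auto
    then have "length (x # M @ [t]) < 5" "odd (length M)" using tri by blast+
    then show "length M = 1" by simp presburger
  qed
  note cover = short_ears_cover[OF gr insep cyc(1) short]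
  have no5: False if "distinct [a, b, c, d, e]" "{a, b} \<in> E" "{b, c} \<in> E" "{c, d} \<in> E" "{d, e} \<in> E" "{e, a} \<in> E" for a b c d e
  proof -
    have "is_cycle_list E [a, b, c, d, e]" using that by (simp add: is_cycle_list_iff cycle_edges_Cons)
    then have "odd (length [a, b, c, d, e]) \<longrightarrow> length [a, b, c, d, e] < 5" using tri by blast
    then show False by simp
  qed
  define N where "N = \<Union>E - ?S"
  have N2: "\<exists>s\<in>?S. \<exists>t\<in>?S. s \<noteq> t \<and> {z, s} \<in> E \<and> {z, t} \<in> E" if "z \<in> N" for z
    using that cover(2) unfolding N_def by blast
  have E_cases: "\<exists>s q. e = {s, q} \<and> s \<in> ?S \<and> s \<noteq> q \<and> (q \<in> ?S \<or> q \<in> N)" if "e \<in> E" for e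
  proof -
    obtain s where s: "s \<in> e" "s \<in> ?S" using cover(1)[OF \<open>e \<in> E\<close>] by blast
    obtain q where "e = {s, q}" "q \<noteq> s" using graph_edge_at[OF gr \<open>e \<in> E\<close> s(1)] by blast
    moreover have "q \<in> ?S \<or> q \<in> N" using calculation \<open>e \<in> E\<close> by (auto simp: N_def)
    ultimately show ?thesis using s(2) by blast
  qed
  show ?thesis
  proof (cases "\<exists>y\<in>N. \<forall>s\<in>?S. {y, s} \<in> E")
    case True
    then obtain y where y: "y \<in> N" "\<forall>s\<in>?S. {y, s} \<in> E" by blast
    have ynS: "y \<notin> ?S" using y(1) by (simp add: N_def)
    have "z = y" if "z \<in> N" for z
    proof (rule ccontr)
      assume "z \<noteq> y"
      obtain p q where pq: "p \<in> ?S" "q \<in> ?S" "p \<noteq> q" "{z, p} \<in> E" "{z, q} \<in> E" using N2[OF \<open>z \<in> N\<close>] by blast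
      obtain r where r: "r \<in> ?S" "r \<noteq> p" "r \<noteq> q" using vs dist by (metis distinct_length_2_or_more list.set_intros(1,2))
      have "z \<notin> ?S" using that by (simp add: N_def)
      \<comment> \<open>The forbidden 5-cycle: \<open>z\<close> joins \<open>p\<close> and
        \<open>q\<close>, the triangle joins \<open>q\<close> and \<open>r\<close>, and
        \<open>y\<close>, adjacent to all three, joins \<open>r\<close> and
        \<open>p\<close>.\<close>
      then have "distinct [p, z, q, r, y]" using pq r ynS \<open>z \<noteq> y\<close> by auto
      then show False using no5[of p z q r y] pq r y(2) inS by (simp add: insert_commute)
    qed
    then have N: "N = {y}" using y(1) by blast
    have "E \<subseteq> {{x1, x2}, {x1, x3}, {x1, y}, {x2, x3}, {x2, y}, {x3, y}}"
    proof
      fix e assume "e \<in> E"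
      then obtain s q where "e = {s, q}" "s \<in> ?S" "s \<noteq> q" "q \<in> ?S \<or> q = y" using E_cases N by blast
      then show "e \<in> {{x1, x2}, {x1, x3}, {x1, y}, {x2, x3}, {x2, y}, {x3, y}}"
        using vs by (auto simp: insert_commute)
    qed
    moreover have "{{x1, x2}, {x1, x3}, {x1, y}, {x2, x3}, {x2, y}, {x3, y}} \<subseteq> E"
      using y(2) vs dist inS by (auto simp: insert_commute)
    ultimately have "E = {{x1, x2}, {x1, x3}, {x1, y}, {x2, x3}, {x2, y}, {x3, y}}" by blast
    moreover have "distinct [x1, x2, x3, y]" using dist ynS vs by auto
    ultimately show ?thesis
      by (intro disjI2, rule_tac x = x1 in exI, rule_tac x = x2 in exI, rule_tac x = x3 in exI,
          rule_tac x = y in exI, intro conjI)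
  next
    case False
    obtain u v x where uvx: "?S = {u, v, x}" "u \<noteq> v" "u \<noteq> x" "v \<noteq> x"
      "\<forall>z\<in>N. {z, u} \<in> E \<and> {z, v} \<in> E \<and> {z, x} \<notin> E"
    proof (cases "N = {}")
      case True
      then show ?thesis using vs dist by (intro that[of x1 x2 x3]) auto
    next
      case N: False
      then obtain y where y: "y \<in> N" by blast
      obtain u v where uv: "u \<in> ?S" "v \<in> ?S" "u \<noteq> v" "{y, u} \<in> E" "{y, v} \<in> E" using N2[OF y] by blast
      obtain x where x: "x \<in> ?S" "x \<noteq> u" "x \<noteq> v" using vs dist by (metis distinct_length_2_or_more list.set_intros(1,2))
      have S: "?S = {u, v, x}" using uv(1-3) x vs dist by auto
      have yx: "{y, x} \<notin> E" using False y uv(4,5) S by auto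
      have ynS: "y \<notin> ?S" using y by (simp add: N_def)
      have "{z, u} \<in> E \<and> {z, v} \<in> E \<and> {z, x} \<notin> E" if z: "z \<in> N" for z
      proof -
        have znS: "z \<notin> ?S" using z by (simp add: N_def)
        obtain p q where pq: "p \<in> ?S" "q \<in> ?S" "p \<noteq> q" "{z, p} \<in> E" "{z, q} \<in> E" using N2[OF z] by blast
        have "{z, x} \<notin> E"
        proof
          assume zx: "{z, x} \<in> E"
          then have "z \<noteq> y" using yx by blast
          have "{z, u} \<in> E \<or> {z, v} \<in> E" using pq S by auto
          \<comment> \<open>If \<open>z\<close> saw the third vertex \<open>x\<close>, a 5-cycle
            would run through \<open>y\<close> between \<open>u\<close> and \<open>v\<close> and
            through \<open>z\<close> from one of these to \<open>x\<close>.\<close>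
          moreover have "distinct [v, y, u, z, x]" "distinct [u, y, v, z, x]"
            using ynS znS \<open>z \<noteq> y\<close> S uv(3) x by auto
          moreover have "{x, u} \<in> E" "{x, v} \<in> E" using inS S x by auto
          ultimately show False
            using no5[of v y u z x] no5[of u y v z x] uv(4,5) zx by (auto simp: insert_commute)
        qed
        then show ?thesis using pq S by auto
      qed
      then show ?thesis using S uv(3) x by (intro that[of u v x]) auto
    qed
    define Y where "Y = insert x N"
    have notY: "u \<notin> Y" "v \<notin> Y" using uvx by (auto simp: Y_def N_def)
    have uvE: "{u, v} \<in> E" "{u, x} \<in> E" "{v, x} \<in> E" using inS uvx by auto
    have "E \<subseteq> {{u, v}} \<union> (\<lambda>y. {u, y}) ` Y \<union> (\<lambda>y. {v, y}) ` Y"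
    proof
      fix e assume e: "e \<in> E"
      then obtain s q where sq: "e = {s, q}" "s \<in> ?S" "s \<noteq> q" "q \<in> ?S \<or> q \<in> N" using E_cases by blast
      from sq(4) show "e \<in> {{u, v}} \<union> (\<lambda>y. {u, y}) ` Y \<union> (\<lambda>y. {v, y}) ` Y"
      proof
        assume "q \<in> ?S"
        then have "e = {u, v} \<or> e = {u, x} \<or> e = {v, x}" using sq uvx(1) by auto
        then show ?thesis by (auto simp: Y_def)
      next
        assume q: "q \<in> N"
        then have "s \<noteq> x" using uvx(5) e sq(1) by (auto simp: insert_commute)
        then show ?thesis using q sq uvx(1) by (auto simp: Y_def)
      qed
    qed
    moreover have "{{u, v}} \<union> (\<lambda>y. {u, y}) ` Y \<union> (\<lambda>y. {v, y}) ` Y \<subseteq> E"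
      using uvE uvx(5) by (auto simp: Y_def insert_commute)
    ultimately have "E = {{u, v}} \<union> (\<lambda>y. {u, y}) ` Y \<union> (\<lambda>y. {v, y}) ` Y" by blast
    then show ?thesis using notY uvx(2) by blast
  qed
qed

section \<open>List colouring the exceptional graphs\<close>

lemma ex_fresh: "finite X \<Longrightarrow> card X < card A \<Longrightarrow> \<exists>x\<in>A. x \<notin> X"
  by (meson card_mono not_le subsetI)

lemma ex_fresh1: "card A \<ge> 2 \<Longrightarrow> \<exists>x\<in>A. x \<noteq> p"
  using ex_fresh[of "{p}" A] by auto

lemma ex_fresh2:
  assumes "card A \<ge> 3"
  shows "\<exists>x\<in>A. x \<noteq> p \<and> x \<noteq> q"
proof -
  have "card {p, q} < card A" using assms by (simp add: card_insert_if)
  then show ?thesis using ex_fresh[of "{p, q}" A] by auto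
qed

text \<open>A colour common to the opposite lists \<open>A\<close> and \<open>C\<close> is used
  twice. If they are disjoint, any \<open>b\<close> is missing from one of them; colouring around
  the cycle from \<open>b\<close> and ending at that list leaves only one colour to avoid at the
  end.\<close>

lemma four_cycle_choosable:
  assumes "card A \<ge> 2" "card B \<ge> 2" "card C \<ge> 2" "card D \<ge> 2"
  shows "\<exists>a\<in>A. \<exists>b\<in>B. \<exists>c\<in>C. \<exists>d\<in>D. a \<noteq> b \<and> b \<noteq> c \<and> c \<noteq> d \<and> d \<noteq> a"
proof (cases "A \<inter> C = {}")
  case False
  then obtain x where "x \<in> A" "x \<in> C" by blast
  moreover obtain b where "b \<in> B" "b \<noteq> x" using ex_fresh1[OF assms(2)] by blast
  moreover obtain d where "d \<in> D" "d \<noteq> x" using ex_fresh1[OF assms(4)] by blast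
  ultimately show ?thesis by metis
next
  case True
  obtain b where b: "b \<in> B" using ex_fresh1[OF assms(2)] by blast
  show ?thesis
  proof (cases "b \<in> A")
    case False
    obtain c where "c \<in> C" "c \<noteq> b" using ex_fresh1[OF assms(3)] by blast
    moreover obtain d where "d \<in> D" "d \<noteq> c" using ex_fresh1[OF assms(4)] by blast
    moreover obtain a where "a \<in> A" "a \<noteq> d" using ex_fresh1[OF assms(1)] by blast
    ultimately show ?thesis using b False by metis
  next
    case b': True
    obtain a where "a \<in> A" "a \<noteq> b" using ex_fresh1[OF assms(1)] by blast
    moreover obtain d where "d \<in> D" "d \<noteq> a" using ex_fresh1[OF assms(4)] by blast
    moreover obtain c where "c \<in> C" "c \<noteq> d" using ex_fresh1[OF assms(3)] by blast
    moreover have "c \<noteq> b" if "c \<in> C" for c using b' True that by blast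
    ultimately show ?thesis using b by metis
  qed
qed

lemma card_Diff_singleton_ge: "card A \<ge> Suc n \<Longrightarrow> card (A - {x}) \<ge> n"
  by (auto simp: card_Diff_singleton_if)

text \<open>The line graph of \<open>K\<^sub>4\<close> minus an edge is a wheel: \<open>h\<close> belongs to the edge joining the two
  vertices of degree 3, and \<open>a\<close>, \<open>b\<close> to the edges at the root.\<close>
lemma wheel_choosable:
  assumes "card A \<ge> 2" "card B \<ge> 2" "card C \<ge> 3" "card D \<ge> 3" "card H \<ge> 3"
  shows "\<exists>a\<in>A. \<exists>b\<in>B. \<exists>c\<in>C. \<exists>d\<in>D. \<exists>h\<in>H. a \<noteq> b \<and> b \<noteq> c \<and> c \<noteq> d \<and> d \<noteq> a \<and> h \<notin> {a, b, c, d}"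
proof -
  consider (AC) "A \<inter> C \<noteq> {}" | (BD) "B \<inter> D \<noteq> {}" | (disj) "A \<inter> C = {}" "B \<inter> D = {}" by blast
  then show ?thesis
  proof cases
    case AC
    then obtain x where "x \<in> A" "x \<in> C" by blast
    moreover obtain b where "b \<in> B" "b \<noteq> x" using ex_fresh1[OF assms(2)] by blast
    moreover obtain h where "h \<in> H" "h \<noteq> x" "h \<noteq> b" using ex_fresh2[OF assms(5)] by blast
    moreover obtain d where "d \<in> D" "d \<noteq> x" "d \<noteq> h" using ex_fresh2[OF assms(4)] by blast
    ultimately have "x \<in> A \<and> b \<in> B \<and> x \<in> C \<and> d \<in> D \<and> h \<in> H \<and> x \<noteq> b \<and> b \<noteq> x \<and> x \<noteq> d \<and> d \<noteq> x \<and> h \<notin> {x, b, x, d}"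
      by auto
    then show ?thesis by blast
  next
    case BD
    then obtain x where "x \<in> B" "x \<in> D" by blast
    moreover obtain a where "a \<in> A" "a \<noteq> x" using ex_fresh1[OF assms(1)] by blast
    moreover obtain h where "h \<in> H" "h \<noteq> x" "h \<noteq> a" using ex_fresh2[OF assms(5)] by blast
    moreover obtain c where "c \<in> C" "c \<noteq> x" "c \<noteq> h" using ex_fresh2[OF assms(3)] by blast
    ultimately have "a \<in> A \<and> x \<in> B \<and> c \<in> C \<and> x \<in> D \<and> h \<in> H \<and> a \<noteq> x \<and> x \<noteq> c \<and> c \<noteq> x \<and> x \<noteq> a \<and> h \<notin> {a, x, c, x}"
      by auto
    then show ?thesis by blast
  next
    case disj
    \<comment> \<open>With \<open>A\<close> and \<open>B\<close> cut down to two colours, three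
      colours for the hub allow an \<open>h\<close> outside \<open>A0\<close>. If \<open>h\<close>
      also misses \<open>B0\<close>, the rim is a 4-cycle with lists of size 2. If \<open>h\<close>
      lies in \<open>B0\<close>, then disjointness keeps it out of \<open>D\<close>, so
      \<open>d\<close> can be chosen last, avoiding only \<open>a\<close> and
      \<open>c\<close>.\<close>
    obtain A0 where A0: "A0 \<subseteq> A" "card A0 = 2" "finite A0" using obtain_subset_with_card_n[OF assms(1)] by blast
    obtain B0 where B0: "B0 \<subseteq> B" "card B0 = 2" using obtain_subset_with_card_n[OF assms(2)] by blast
    obtain h where h: "h \<in> H" "h \<notin> A0" using ex_fresh[of A0 H] A0 assms(5) by auto
    show ?thesis
    proof (cases "h \<in> B0")
      case False
      have "card A0 \<ge> 2" "card B0 \<ge> 2" "card (C - {h}) \<ge> 2" "card (D - {h}) \<ge> 2"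
        using A0 B0 assms card_Diff_singleton_ge[of 2 C h] card_Diff_singleton_ge[of 2 D h] by auto
      from four_cycle_choosable[OF this] obtain a b c d where
        "a \<in> A0" "b \<in> B0" "c \<in> C - {h}" "d \<in> D - {h}" "a \<noteq> b" "b \<noteq> c" "c \<noteq> d" "d \<noteq> a" by blast
      then have "a \<in> A \<and> b \<in> B \<and> c \<in> C \<and> d \<in> D \<and> h \<in> H \<and> a \<noteq> b \<and> b \<noteq> c \<and> c \<noteq> d \<and> d \<noteq> a \<and> h \<notin> {a, b, c, d}"
        using h False A0(1) B0(1) by auto
      then show ?thesis by blast
    next
      case True
      then have "h \<notin> D" using B0 disj by blast
      obtain b where b: "b \<in> B0" "b \<noteq> h" using ex_fresh1[of B0] B0 by auto
      obtain c where c: "c \<in> C" "c \<noteq> h" "c \<noteq> b" using ex_fresh2[OF assms(3)] by blast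
      obtain a where a: "a \<in> A0" "a \<noteq> b" using ex_fresh1[of A0] A0 by auto
      obtain d where d: "d \<in> D" "d \<noteq> a" "d \<noteq> c" using ex_fresh2[OF assms(4)] by blast
      have "a \<in> A \<and> b \<in> B \<and> c \<in> C \<and> d \<in> D \<and> h \<in> H \<and> a \<noteq> b \<and> b \<noteq> c \<and> c \<noteq> d \<and> d \<noteq> a \<and> h \<notin> {a, b, c, d}"
        using a b c d h \<open>h \<notin> D\<close> A0(1) B0(1) by auto
      then show ?thesis by blast
    qed
  qed
qed

text \<open>The line graph of \<open>K\<^sub>4\<close> is the octahedron. A list and its primed
  partner belong to disjoint edges of \<open>K\<^sub>4\<close>, the only pairs that may receive
  equal colours.\<close>

definition octahedron_coloring :: "'c set \<Rightarrow> 'c set \<Rightarrow> 'c set \<Rightarrow> 'c set \<Rightarrow> 'c set \<Rightarrow> 'c set \<Rightarrow> bool" where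
  "octahedron_coloring A A' B B' C C' \<longleftrightarrow> (\<exists>a a' b b' c c'. a \<in> A \<and> a' \<in> A' \<and> b \<in> B \<and> b' \<in> B' \<and>
    c \<in> C \<and> c' \<in> C' \<and> {a, a'} \<inter> {b, b', c, c'} = {} \<and> {b, b'} \<inter> {c, c'} = {})"

lemma octahedron_coloringI:
  "a \<in> A \<Longrightarrow> a' \<in> A' \<Longrightarrow> b \<in> B \<Longrightarrow> b' \<in> B' \<Longrightarrow> c \<in> C \<Longrightarrow> c' \<in> C' \<Longrightarrow>
    {a, a'} \<inter> {b, b', c, c'} = {} \<Longrightarrow> {b, b'} \<inter> {c, c'} = {} \<Longrightarrow> octahedron_coloring A A' B B' C C'"
  unfolding octahedron_coloring_def by blast

lemma octahedron_coloring_swap: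
  assumes "octahedron_coloring A A' B B' C C'"
  shows "octahedron_coloring A A' B' B C C'" "octahedron_coloring A A' C C' B B'"
    "octahedron_coloring A' A B B' C C'" "octahedron_coloring B B' A A' C C'"
proof -
  obtain a a' b b' c c' where "a \<in> A" "a' \<in> A'" "b \<in> B" "b' \<in> B'" "c \<in> C" "c' \<in> C'"
    "{a, a'} \<inter> {b, b', c, c'} = {}" "{b, b'} \<inter> {c, c'} = {}"
    using assms unfolding octahedron_coloring_def by metis
  then show "octahedron_coloring A A' B' B C C'" "octahedron_coloring A A' C C' B B'"
    "octahedron_coloring A' A B B' C C'" "octahedron_coloring B B' A A' C C'"
    by (auto intro: octahedron_coloringI[of a A a' A' b' B' b B c C c'] octahedron_coloringI[of a A a' A' c C c' C' b B b']
      octahedron_coloringI[of a' A' a A b B b' B' c C c'] octahedron_coloringI[of b B b' B' a A a' A' c C c'])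
qed

text \<open>Using the common colour twice leaves a 4-cycle with lists of size 2.\<close>

lemma octahedron_choosable_common:
  assumes "card B \<ge> 3" "card B' \<ge> 3" "card C \<ge> 3" "card C' \<ge> 3" "A \<inter> A' \<noteq> {}"
  shows "octahedron_coloring A A' B B' C C'"
proof -
  obtain x where x: "x \<in> A" "x \<in> A'" using assms(5) by blast
  have "card (B - {x}) \<ge> 2" "card (C - {x}) \<ge> 2" "card (B' - {x}) \<ge> 2" "card (C' - {x}) \<ge> 2"
    using assms by (auto intro!: card_Diff_singleton_ge)
  from four_cycle_choosable[OF this] obtain b c b' c' where
    "b \<in> B - {x}" "c \<in> C - {x}" "b' \<in> B' - {x}" "c' \<in> C' - {x}" "b \<noteq> c" "c \<noteq> b'" "b' \<noteq> c'" "c' \<noteq> b" by blast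
  then show ?thesis using x by (intro octahedron_coloringI[of x A x A' b B b' B' c C c' C']) auto
qed

text \<open>\<open>p\<close>, \<open>q\<close>, \<open>r\<close> go to \<open>A\<close>,
  \<open>B\<close>, \<open>C\<close>. Disjointness from the partners keeps all three out of
  \<open>B'\<close> and \<open>C'\<close> and \<open>p\<close> out of \<open>A'\<close>, so
  \<open>a'\<close>, \<open>b'\<close>, \<open>c'\<close> can be chosen in this order, each avoiding
  at most two further colours.\<close>

lemma octahedron_choosable_equal:
  assumes "card A' \<ge> 3" "card B' \<ge> 3" "card C' \<ge> 3" "A \<inter> A' = {}" "B \<inter> B' = {}" "C \<inter> C' = {}"
    "{p, q, r} \<subseteq> B" "{p, q, r} \<subseteq> C" "p \<in> A" "r \<notin> A" "distinct [p, q, r]" "q \<in> A'"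
  shows "octahedron_coloring A A' B B' C C'"
proof -
  obtain a' where a': "a' \<in> A'" "a' \<noteq> q" "a' \<noteq> r" using ex_fresh2[OF assms(1)] by blast
  obtain b' where b': "b' \<in> B'" "b' \<noteq> a'" using ex_fresh2[OF assms(2)] by blast
  obtain c' where c': "c' \<in> C'" "c' \<noteq> a'" "c' \<noteq> b'" using ex_fresh2[OF assms(3)] by blast
  have "p \<notin> B'" "q \<notin> B'" "r \<notin> B'" "p \<notin> C'" "q \<notin> C'" "r \<notin> C'" "p \<notin> A'" using assms by blast+
  then have "{p, a'} \<inter> {q, b', r, c'} = {}" "{q, b'} \<inter> {r, c'} = {}"
    using a' b' c' assms(11) by auto
  then show ?thesis using a' b' c' assms(7-9)
    by (intro octahedron_coloringI[of p A a' A' q B b' B' r C c' C']) auto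
qed

text \<open>Here \<open>B = {p, q, r}\<close>. Unless \<open>C\<close> or \<open>C'\<close> equals
  this set too, both contain a colour outside it, and \<open>p\<close>, \<open>q\<close>,
  \<open>r\<close> can serve for \<open>a\<close>, \<open>a'\<close>, \<open>b\<close>; the list
  \<open>B'\<close> contains none of the three, so \<open>b'\<close> only has to avoid
  \<open>c\<close> and \<open>c'\<close>.\<close>

lemma octahedron_choosable_aux:
  assumes "card A = 3" "card A' = 3" "card B = 3" "card B' = 3" "card C = 3" "card C' = 3"
    "A \<inter> A' = {}" "B \<inter> B' = {}" "C \<inter> C' = {}" "p \<in> A" "q \<in> A'" "p \<in> B" "q \<in> B"
  shows "octahedron_coloring A A' B B' C C'"
proof -
  have "p \<noteq> q" using assms by blast
  obtain r where r: "r \<in> B" "r \<noteq> p" "r \<noteq> q" using ex_fresh2[of B p q] assms(3) by auto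
  have dist: "distinct [p, q, r]" using r \<open>p \<noteq> q\<close> by simp
  then have card3: "card {p, q, r} = 3" by simp
  have eq: "octahedron_coloring A A' B B' D D'"
    if "D \<subseteq> {p, q, r}" "card D = 3" "card D' = 3" "D \<inter> D' = {}" for D D'
  proof -
    have "D = {p, q, r}" using card_subset_eq[of "{p, q, r}" D] that card3 by simp
    show ?thesis
    proof (cases "r \<in> A")
      case False
      then show ?thesis using octahedron_choosable_equal[of A' B' D' A B D p q r] assms that r dist \<open>D = _\<close> by simp
    next
      case True
      then have "r \<notin> A'" using assms(7) by blast
      then have "octahedron_coloring A' A B B' D D'"
        using octahedron_choosable_equal[of A B' D' A' B D q p r] assms that r dist \<open>D = _\<close> by (simp add: Int_commute)
      then show ?thesis by (rule octahedron_coloring_swap(3))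
    qed
  qed
  consider "C \<subseteq> {p, q, r}" | "C' \<subseteq> {p, q, r}" | c c' where "c \<in> C - {p, q, r}" "c' \<in> C' - {p, q, r}" by blast
  then show ?thesis
  proof cases
    case 1
    then show ?thesis using eq assms by blast
  next
    case 2
    then have "octahedron_coloring A A' B B' C' C" using eq assms by blast
    then show ?thesis
      by (rule octahedron_coloring_swap(2)[OF octahedron_coloring_swap(1)[OF octahedron_coloring_swap(2)]])
  next
    case 3
    obtain b' where b': "b' \<in> B'" "b' \<noteq> c" "b' \<noteq> c'" using ex_fresh2[of B' c c'] assms(4) by auto
    have "p \<notin> B'" "q \<notin> B'" using assms by blast+
    then show ?thesis using 3 b' r assms \<open>p \<noteq> q\<close>
      by (intro octahedron_coloringI[of p A q A' r B b' B' c C c' C']) auto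
  qed
qed

text \<open>If partners are disjoint, \<open>p\<close> and \<open>q\<close> are tried on the first
  pair. When no other list contains both, each loses at most one colour and a 4-cycle with lists of
  size 2 remains; a list containing both leads to \<open>octahedron_choosable_aux\<close>.\<close>

lemma octahedron_choosable:
  assumes "card A \<ge> 3" "card A' \<ge> 3" "card B \<ge> 3" "card B' \<ge> 3" "card C \<ge> 3" "card C' \<ge> 3"
  shows "octahedron_coloring A A' B B' C C'"
proof -
  consider (A) "A \<inter> A' \<noteq> {}" | (B) "B \<inter> B' \<noteq> {}" | (C) "C \<inter> C' \<noteq> {}"
    | (disj) "A \<inter> A' = {}" "B \<inter> B' = {}" "C \<inter> C' = {}" by blast
  then show ?thesis
  proof cases
    case A
    then show ?thesis using assms octahedron_choosable_common by blast
  next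
    case B
    then have "octahedron_coloring B B' A A' C C'" using assms octahedron_choosable_common by blast
    then show ?thesis by (rule octahedron_coloring_swap(4))
  next
    case C
    then have "octahedron_coloring C C' A A' B B'" using assms octahedron_choosable_common by blast
    then show ?thesis by (rule octahedron_coloring_swap(2)[OF octahedron_coloring_swap(4)])
  next
    case disj
    have sub: "\<exists>X0\<subseteq>X. card X0 = 3" if "card X \<ge> 3" for X :: "'a set"
      using obtain_subset_with_card_n[OF that] by metis
    obtain X X' Y Y' Z Z' where sub: "X \<subseteq> A" "X' \<subseteq> A'" "Y \<subseteq> B" "Y' \<subseteq> B'" "Z \<subseteq> C" "Z' \<subseteq> C'"
      and cards: "card X = 3" "card X' = 3" "card Y = 3" "card Y' = 3" "card Z = 3" "card Z' = 3"
      using sub[OF assms(1)] sub[OF assms(2)] sub[OF assms(3)] sub[OF assms(4)] sub[OF assms(5)] sub[OF assms(6)] by metis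
    have disj': "X \<inter> X' = {}" "Y \<inter> Y' = {}" "Z \<inter> Z' = {}" using disj sub by blast+
    then have disj'': "Y' \<inter> Y = {}" "Z' \<inter> Z = {}" by blast+
    obtain p where p: "p \<in> X" using cards(1) by (metis card.empty equals0I zero_neq_numeral)
    obtain q where q: "q \<in> X'" using cards(2) by (metis card.empty equals0I zero_neq_numeral)
    have "octahedron_coloring X X' Y Y' Z Z'"
    proof -
      have big: "card (W - {p, q}) \<ge> 2" if "card W = 3" "\<not> (p \<in> W \<and> q \<in> W)" for W
      proof -
        have "W - {p, q} = W - {p} \<or> W - {p, q} = W - {q}" using that(2) by blast
        moreover have "card (W - {p}) \<ge> 2" "card (W - {q}) \<ge> 2"
          using that(1) by (auto intro!: card_Diff_singleton_ge)
        ultimately show ?thesis by metis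
      qed
      consider "p \<in> Y \<and> q \<in> Y" | "p \<in> Y' \<and> q \<in> Y'" | "p \<in> Z \<and> q \<in> Z" | "p \<in> Z' \<and> q \<in> Z'"
        | "\<not> (p \<in> Y \<and> q \<in> Y)" "\<not> (p \<in> Y' \<and> q \<in> Y')" "\<not> (p \<in> Z \<and> q \<in> Z)" "\<not> (p \<in> Z' \<and> q \<in> Z')" by blast
      then show ?thesis
      proof cases
        case 1
        then show ?thesis using octahedron_choosable_aux[OF cards disj' p q] by blast
      next
        case 2
        then have "octahedron_coloring X X' Y' Y Z Z'"
          using octahedron_choosable_aux[OF cards(1,2,4,3,5,6) disj'(1) disj''(1) disj'(3) p q] by blast
        then show ?thesis by (rule octahedron_coloring_swap(1))
      next
        case 3
        then have "octahedron_coloring X X' Z Z' Y Y'"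
          using octahedron_choosable_aux[OF cards(1,2,5,6,3,4) disj'(1,3,2) p q] by blast
        then show ?thesis by (rule octahedron_coloring_swap(2))
      next
        case 4
        then have "octahedron_coloring X X' Z' Z Y Y'"
          using octahedron_choosable_aux[OF cards(1,2,6,5,3,4) disj'(1) disj''(2) disj'(2) p q] by blast
        then show ?thesis by (rule octahedron_coloring_swap(2)[OF octahedron_coloring_swap(1)])
      next
        case 5
        then have "card (Y - {p, q}) \<ge> 2" "card (Z - {p, q}) \<ge> 2" "card (Y' - {p, q}) \<ge> 2" "card (Z' - {p, q}) \<ge> 2"
          using big cards by blast+
        from four_cycle_choosable[OF this] obtain b c b' c' where
          "b \<in> Y - {p, q}" "c \<in> Z - {p, q}" "b' \<in> Y' - {p, q}" "c' \<in> Z' - {p, q}"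
          "b \<noteq> c" "c \<noteq> b'" "b' \<noteq> c'" "c' \<noteq> b" by blast
        then show ?thesis using p q by (intro octahedron_coloringI[of p X q X' b Y b' Y' c Z c' Z']) auto
      qed
    qed
    then obtain a a' b b' c c' where col: "a \<in> X" "a' \<in> X'" "b \<in> Y" "b' \<in> Y'" "c \<in> Z" "c' \<in> Z'"
      "{a, a'} \<inter> {b, b', c, c'} = {}" "{b, b'} \<inter> {c, c'} = {}"
      unfolding octahedron_coloring_def by metis
    show ?thesis
      by (rule octahedron_coloringI[OF subsetD[OF sub(1) col(1)] subsetD[OF sub(2) col(2)]
            subsetD[OF sub(3) col(3)] subsetD[OF sub(4) col(4)] subsetD[OF sub(5) col(5)]
            subsetD[OF sub(6) col(6)] col(7,8)])
  qed
qed

section \<open>Extending partial colourings; the exceptional graphs\<close>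

lemma list_colorable_extend:
  assumes "proper_edge_coloring F g" "\<forall>e\<in>F. g e \<in> L e"
    "list_colorable (E - F) (\<lambda>e. L e - g ` {e' \<in> F. e' \<inter> e \<noteq> {}})"
  shows "list_colorable E L"
proof -
  obtain h where h: "proper_edge_coloring (E - F) h" "\<forall>e\<in>E - F. h e \<in> L e - g ` {e' \<in> F. e' \<inter> e \<noteq> {}}"
    using assms(3) unfolding list_colorable_def by blast
  define c where "c e = (if e \<in> F then g e else h e)" for e
  have mixed: "g e1 \<noteq> h e2" if "e1 \<in> F" "e2 \<in> E - F" "v \<in> e1" "v \<in> e2" for e1 e2 v
  proof -
    have "h e2 \<notin> g ` {e' \<in> F. e' \<inter> e2 \<noteq> {}}" using h(2) that(2) by blast
    moreover have "e1 \<in> {e' \<in> F. e' \<inter> e2 \<noteq> {}}" using that by blast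
    ultimately show ?thesis by (metis imageI)
  qed
  have "proper_edge_coloring E c"
  proof (rule proper_edge_coloringI)
    fix e1 e2 v assume e: "e1 \<in> E" "e2 \<in> E" "v \<in> e1" "v \<in> e2" "e1 \<noteq> e2"
    then show "c e1 \<noteq> c e2"
      using proper_edge_coloringD[OF assms(1), of e1 e2 v] proper_edge_coloringD[OF h(1), of e1 e2 v]
        mixed[of e1 e2 v] mixed[of e2 e1 v]
      by (cases "e1 \<in> F"; cases "e2 \<in> F") (auto simp: c_def)
  qed
  moreover have "\<forall>e\<in>E. c e \<in> L e" using assms(2) h(2) by (auto simp: c_def)
  ultimately show ?thesis unfolding list_colorable_def by blast
qed

lemma list_colorable_empty: "list_colorable {} L"
  by (simp add: list_colorable_def proper_edge_coloring_def)

lemma deg_mono: "finite E \<Longrightarrow> F \<subseteq> E \<Longrightarrow> deg F v \<le> deg E v"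
  unfolding deg_def by (intro card_mono) auto

lemma deg_Diff:
  assumes "finite E" "F \<subseteq> E"
  shows "deg E v = deg F v + deg (E - F) v"
proof -
  have "{e \<in> E. v \<in> e} = {e \<in> F. v \<in> e} \<union> {e \<in> E - F. v \<in> e}" using assms(2) by auto
  moreover have "card ({e \<in> F. v \<in> e} \<union> {e \<in> E - F. v \<in> e}) = card {e \<in> F. v \<in> e} + card {e \<in> E - F. v \<in> e}"
    using assms(1) finite_subset[OF assms(2,1)] by (intro card_Un_disjoint) auto
  ultimately show ?thesis by (simp add: deg_def)
qed

lemma deg_singleton: "v \<in> e \<Longrightarrow> deg {e} v = 1"
proof -
  assume "v \<in> e"
  then have "{e' \<in> {e}. v \<in> e'} = {e}" by auto
  then show ?thesis by (simp add: deg_def)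
qed

text \<open>The shorter lists at \<open>w\<close> model a cut vertex whose other blocks are coloured already.\<close>
definition rooted_lists :: "'a set set \<Rightarrow> nat \<Rightarrow> 'a \<Rightarrow> ('a set \<Rightarrow> nat set) \<Rightarrow> bool" where
  "rooted_lists E k w L \<longleftrightarrow> (\<forall>e\<in>E. finite (L e) \<and> (if w \<in> e then deg E w else k) \<le> card (L e))"

lemma rooted_listsD:
  assumes "rooted_lists E k w L" "e \<in> E"
  shows "finite (L e)" "w \<in> e \<Longrightarrow> deg E w \<le> card (L e)" "w \<notin> e \<Longrightarrow> k \<le> card (L e)"
  using assms by (auto simp: rooted_lists_def)

text \<open>Colouring \<open>{u, v}\<close> first lowers the degrees at \<open>u\<close> and
  \<open>v\<close> by one and costs each neighbouring edge at most one colour; all other degrees are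
  at most \<open>2 \<le> k - 1\<close>. So the bipartite result applies with \<open>k - 1\<close>,
  provided the root keeps its lists.\<close>

lemma list_colorable_near_bipartite:
  assumes gr: "graph E" and uv: "{u, v} \<in> E" and bip: "bipartition f (E - {{u, v}})"
    and deg: "\<forall>z. deg E z \<le> k" "\<forall>z. z \<notin> {u, v} \<longrightarrow> deg E z \<le> 2" and "k \<ge> 3"
    and w: "\<not> ({u, w} \<in> E \<and> {v, w} \<in> E)" and L: "rooted_lists E k w L"
  shows "list_colorable E L"
proof -
  have finE: "finite E" using gr by (simp add: graph_def)
  let ?e = "{u, v}"
  have degE: "deg E z = deg {?e} z + deg (E - {?e}) z" for z using deg_Diff[OF finE, of "{?e}" z] uv by simp
  \<comment> \<open>The critical edge joins \<open>w\<close> to \<open>u\<close> or \<open>v\<close>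
    from outside: it may have only \<open>deg E w\<close> colours, and this degree does not drop. At
    most one such edge exists, and its degree bound is 2. So \<open>M\<close> reserves
    \<open>deg E w\<close> of its colours, and \<open>{u, v}\<close>, with at least three, is
    coloured outside \<open>M\<close>.\<close>
  have "\<exists>M. finite M \<and> card M < card (L ?e) \<and>
    (\<forall>e\<in>E. w \<in> e \<and> w \<notin> ?e \<and> e \<inter> ?e \<noteq> {} \<longrightarrow> M \<subseteq> L e \<and> deg E w \<le> card M)"
  proof (cases "\<exists>e\<in>E. w \<in> e \<and> w \<notin> ?e \<and> e \<inter> ?e \<noteq> {}")
    case True
    then obtain e where e: "e \<in> E" "w \<in> e" "w \<notin> ?e" "e \<inter> ?e \<noteq> {}" by blast
    have only: "e' = e" if e': "e' \<in> E" "w \<in> e'" "e' \<inter> ?e \<noteq> {}" for e'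
    proof -
      have ends: "d = {u, w} \<or> d = {v, w}" if "d \<in> E" "w \<in> d" "d \<inter> ?e \<noteq> {}" for d
      proof -
        obtain q where "d = {w, q}" using graph_edge_at[OF gr \<open>d \<in> E\<close> \<open>w \<in> d\<close>] by blast
        then show ?thesis using that(3) e(3) by auto
      qed
      show ?thesis using ends[OF e'] ends[OF e(1,2,4)] w e(1) e'(1) by auto
    qed
    have "deg E w \<le> card (L e)" using L e(1,2) by (auto simp: rooted_lists_def)
    then obtain M where M: "M \<subseteq> L e" "card M = deg E w" "finite M" using obtain_subset_with_card_n by metis
    have "k \<le> card (L ?e)" using rooted_listsD(3)[OF L uv] e(3) by blast
    then have "card M < card (L ?e)" using M(2) deg(2) e(3) \<open>k \<ge> 3\<close> by fastforce
    then show ?thesis using M only by (intro exI[of _ M]) auto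
  next
    case False
    have "card (L ?e) > 0"
    proof (cases "w \<in> ?e")
      case True
      then have "deg E w \<ge> 1" using degE[of w] deg_singleton[OF True] by simp
      then show ?thesis using rooted_listsD(2)[OF L uv True] by linarith
    next
      case False
      then have "k \<le> card (L ?e)" using rooted_listsD(3)[OF L uv] by blast
      then show ?thesis using \<open>k \<ge> 3\<close> by simp
    qed
    then show ?thesis using False by (intro exI[of _ "{}"]) auto
  qed
  then obtain M where M: "finite M" "card M < card (L ?e)"
    "\<forall>e\<in>E. w \<in> e \<and> w \<notin> ?e \<and> e \<inter> ?e \<noteq> {} \<longrightarrow> M \<subseteq> L e \<and> deg E w \<le> card M" by blast
  obtain c where c: "c \<in> L ?e" "c \<notin> M" using ex_fresh[OF M(1,2)] by blast
  define L' where "L' e = L e - (\<lambda>_. c) ` {e' \<in> {?e}. e' \<inter> e \<noteq> {}}" for e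
  have L'_meet: "L' e = L e - {c}" if "e \<inter> ?e \<noteq> {}" for e
    using that by (auto simp: L'_def)
  have L'_disj: "L' e = L e" if "e \<inter> ?e = {}" for e
    using that by (auto simp: L'_def)
  have lists: "finite (L' e) \<and> (if w \<in> e then deg (E - {?e}) w else k - 1) \<le> card (L' e)" if e: "e \<in> E - {?e}" for e
  proof -
    have fin: "finite (L e)" and old: "(if w \<in> e then deg E w else k) \<le> card (L e)"
      using L e by (auto simp: rooted_lists_def)
    have le: "card (L e) - 1 \<le> card (L' e)"
      using L'_meet[of e] L'_disj[of e] fin by (cases "e \<inter> ?e = {}") (auto simp: card_Diff_singleton_if)
    have "deg (E - {?e}) w \<le> card (L' e)" if "w \<in> e"
    proof (cases "w \<in> ?e")
      case True
      then show ?thesis using le old that degE[of w] deg_singleton[OF True] by simp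
    next
      case False
      have "deg (E - {?e}) w \<le> deg E w" using degE[of w] by simp
      also have "\<dots> \<le> card (L' e)"
      proof (cases "e \<inter> ?e = {}")
        case True
        then show ?thesis using L'_disj old that by simp
      next
        case meet: False
        then have "M \<subseteq> L e" "deg E w \<le> card M" using M(3) e that False by blast+
        moreover have "card M \<le> card (L e - {c})"
          using calculation c(2) fin by (intro card_mono) auto
        ultimately show ?thesis using L'_meet[OF meet] by simp
      qed
      finally show ?thesis .
    qed
    moreover have "k - 1 \<le> card (L' e)" if "w \<notin> e" using le old that by simp
    moreover have "finite (L' e)" using fin by (simp add: L'_def)
    ultimately show ?thesis by simp
  qed
  have "deg (E - {?e}) z \<le> k - 1" for z
  proof (cases "z \<in> ?e")
    case True
    then show ?thesis using degE[of z] deg_singleton[OF True] deg(1) by (metis add_diff_cancel_left' diff_le_mono)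
  next
    case False
    then have "deg E z \<le> 2" using deg(2) by blast
    then show ?thesis using degE[of z] \<open>k \<ge> 3\<close> by linarith
  qed
  then have "list_colorable (E - {?e}) L'"
    using bipartite_list_colorable_rooted[OF _ bip, of "k - 1" L' w] lists finE by blast
  moreover have "proper_edge_coloring {?e} (\<lambda>_. c)" by (simp add: proper_edge_coloring_def)
  ultimately show ?thesis
    using c(1) list_colorable_extend[of "{?e}" "\<lambda>_. c" L E] unfolding L'_def by simp
qed

lemma list_colorable_K4:
  assumes "distinct [a, b, c, d]" "E = {{a, b}, {a, c}, {a, d}, {b, c}, {b, d}, {c, d}}"
    and L: "\<forall>e\<in>E. card (L e) \<ge> 3"
  shows "list_colorable E L"
proof -
  have "card (L {a, b}) \<ge> 3" "card (L {c, d}) \<ge> 3" "card (L {a, c}) \<ge> 3"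
    "card (L {b, d}) \<ge> 3" "card (L {a, d}) \<ge> 3" "card (L {b, c}) \<ge> 3"
    using L assms(2) by auto
  from octahedron_choosable[OF this] obtain p p' q q' r r' where col:
    "p \<in> L {a, b}" "p' \<in> L {c, d}" "q \<in> L {a, c}" "q' \<in> L {b, d}" "r \<in> L {a, d}" "r' \<in> L {b, c}"
    "{p, p'} \<inter> {q, q', r, r'} = {}" "{q, q'} \<inter> {r, r'} = {}"
    unfolding octahedron_coloring_def by metis
  define g where "g e = (if e = {a, b} then p else if e = {c, d} then p' else if e = {a, c} then q
    else if e = {b, d} then q' else if e = {a, d} then r else r')" for e
  have g: "g {a, b} = p" "g {c, d} = p'" "g {a, c} = q" "g {b, d} = q'" "g {a, d} = r" "g {b, c} = r'"
    using assms(1) by (auto simp: g_def doubleton_eq_iff)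
  have disj: "{a, b} \<inter> {c, d} = {}" "{c, d} \<inter> {a, b} = {}" "{a, c} \<inter> {b, d} = {}" "{b, d} \<inter> {a, c} = {}"
    "{a, d} \<inter> {b, c} = {}" "{b, c} \<inter> {a, d} = {}" using assms(1) by auto
  have "proper_edge_coloring E g"
    unfolding proper_edge_coloring_def assms(2)
    using col(7,8) disj by (simp add: g) blast
  moreover have "\<forall>e\<in>E. g e \<in> L e" using col(1-6) by (simp add: assms(2) g)
  ultimately show ?thesis unfolding list_colorable_def by blast
qed

text \<open>The hard case is a root in \<open>Y\<close>: both its edges, to \<open>u\<close> and to
  \<open>v\<close>, may have only two colours, so \<open>{u, v}\<close> cannot be coloured without
  regard to them. Then the whole triangle \<open>u\<close>, \<open>v\<close>, \<open>w\<close> is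
  coloured at once.\<close>

lemma list_colorable_K11p:
  assumes gr: "graph E" and uv: "u \<noteq> v" "u \<notin> Y" "v \<notin> Y"
    and E: "E = {{u, v}} \<union> (\<lambda>y. {u, y}) ` Y \<union> (\<lambda>y. {v, y}) ` Y"
    and deg: "\<forall>z. deg E z \<le> k" and "k \<ge> 3" and L: "rooted_lists E k w L"
  shows "list_colorable E L"
proof -
  have finE: "finite E" using gr by (simp add: graph_def)
  have uvE: "{u, v} \<in> E" unfolding E by simp
  have bip: "bipartition (\<lambda>z. z \<in> {u, v}) (E - {{u, v}})"
    unfolding bipartition_def
  proof
    fix e assume "e \<in> E - {{u, v}}"
    then obtain y where y: "y \<in> Y" "e = {u, y} \<or> e = {v, y}" unfolding E by blast
    then have "y \<notin> {u, v}" using uv by blast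
    then show "\<exists>x y. e = {x, y} \<and> x \<in> {u, v} \<and> y \<notin> {u, v}" using y(2) by blast
  qed
  have deg2: "deg E z \<le> 2" if "z \<notin> {u, v}" for z
  proof -
    have "{e \<in> E. z \<in> e} \<subseteq> {{u, z}, {v, z}}" using that unfolding E by auto
    then have "card {e \<in> E. z \<in> e} \<le> card {{u, z}, {v, z}}" by (intro card_mono) auto
    also have "\<dots> \<le> 2" by (simp add: card_insert_if)
    finally show ?thesis by (simp add: deg_def)
  qed
  show ?thesis
  proof (cases "w \<in> Y")
    case False
    have "\<not> ({u, w} \<in> E \<and> {v, w} \<in> E)"
    proof
      assume *: "{u, w} \<in> E \<and> {v, w} \<in> E"
      then have "w \<noteq> u" "w \<noteq> v" using graph_edge_distinct[OF gr] by blast+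
      then show False using * False unfolding E by (auto simp: doubleton_eq_iff)
    qed
    then show ?thesis
      using list_colorable_near_bipartite[OF gr uvE bip deg _ \<open>k \<ge> 3\<close> _ L] deg2 by blast
  next
    case True
    then have wuv: "w \<noteq> u" "w \<noteq> v" using uv by blast+
    let ?F = "{{u, v}, {u, w}, {v, w}}"
    have FE: "?F \<subseteq> E" using True unfolding E by blast
    have neq: "{u, v} \<noteq> {u, w}" "{u, v} \<noteq> {v, w}" "{u, w} \<noteq> {v, w}"
      using uv wuv by (auto simp: doubleton_eq_iff)
    have degF: "deg ?F u = 2" "deg ?F v = 2" "deg ?F w = 2"
    proof -
      have "{e \<in> ?F. u \<in> e} = {{u, v}, {u, w}}" "{e \<in> ?F. v \<in> e} = {{u, v}, {v, w}}"
        "{e \<in> ?F. w \<in> e} = {{u, w}, {v, w}}" using uv(1) wuv by auto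
      then show "deg ?F u = 2" "deg ?F v = 2" "deg ?F w = 2" using neq by (simp_all add: deg_def)
    qed
    have "2 \<le> deg E w" using deg_mono[OF finE FE, of w] degF(3) by simp
    moreover have "deg E w \<le> card (L {u, w})" "deg E w \<le> card (L {v, w})"
      using rooted_listsD(2)[OF L] FE by auto
    ultimately have Lw: "card (L {u, w}) \<ge> 2" "card (L {v, w}) \<ge> 2" by linarith+
    have Lk: "finite (L e)" "card (L e) \<ge> k" if "e \<in> E" "w \<notin> e" for e
      using rooted_listsD(1,3)[OF L] that by auto
    have Luv: "card (L {u, v}) \<ge> 3" using Lk(2)[OF uvE] wuv \<open>k \<ge> 3\<close> by simp
    show ?thesis
    \<comment> \<open>The triangle takes two from the degrees of \<open>u\<close> and
      \<open>v\<close>, but every other vertex of \<open>Y\<close> keeps degree 2, so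
      \<open>k - 2 \<ge> 2\<close> is required. For \<open>k = 3\<close> the degree bound at
      \<open>u\<close> leaves a single further vertex in \<open>Y\<close>, and the graph is
      \<open>K\<^sub>4\<close> minus an edge.\<close>
    proof (cases "E - ?F = {} \<or> k \<ge> 4")
      case True
      obtain a where a: "a \<in> L {u, w}" using ex_fresh1[OF Lw(1)] by blast
      obtain b where b: "b \<in> L {v, w}" "b \<noteq> a" using ex_fresh1[OF Lw(2)] by blast
      obtain h where h: "h \<in> L {u, v}" "h \<noteq> a" "h \<noteq> b" using ex_fresh2[OF Luv] by blast
      define g where "g e = (if e = {u, w} then a else if e = {v, w} then b else h)" for e
      have "proper_edge_coloring ?F g"
        using neq b h unfolding proper_edge_coloring_def by (auto simp: g_def)
      moreover have "\<forall>e\<in>?F. g e \<in> L e" using neq a b h by (auto simp: g_def)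
      moreover have "list_colorable (E - ?F) (\<lambda>e. L e - g ` {e' \<in> ?F. e' \<inter> e \<noteq> {}})"
      proof (cases "E - ?F = {}")
        case True
        then show ?thesis using list_colorable_empty by metis
      next
        case False
        then have "k \<ge> 4" using True by blast
        have degE: "deg E z = deg ?F z + deg (E - ?F) z" for z by (rule deg_Diff[OF finE FE])
        have "deg (E - ?F) z \<le> k - 2" for z
        proof (cases "z \<in> {u, v}")
          case True
          then have "deg ?F z = 2" using degF by blast
          then show ?thesis using degE[of z] deg by (metis add_diff_cancel_left' diff_le_mono)
        next
          case False
          then show ?thesis using deg2[OF False] degE[of z] \<open>k \<ge> 4\<close> by linarith
        qed
        moreover have "bipartition (\<lambda>z. z \<in> {u, v}) (E - ?F)"
          using bip by (auto simp: bipartition_def)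
        moreover have "finite (L e - g ` {e' \<in> ?F. e' \<inter> e \<noteq> {}}) \<and>
            (if w \<in> e then deg (E - ?F) w else k - 2) \<le> card (L e - g ` {e' \<in> ?F. e' \<inter> e \<noteq> {}})"
          if e: "e \<in> E - ?F" for e
        proof -
          obtain x y where xy: "y \<in> Y" "e = {x, y}" "x \<in> {u, v}" using e unfolding E by blast
          then have "y \<noteq> w" "y \<notin> {u, v}" using e uv by auto
          then have "w \<notin> e" using xy wuv by auto
          let ?X = "{e' \<in> ?F. e' \<inter> e \<noteq> {}}"
          \<comment> \<open>Of the triangle, only \<open>{u, v}\<close> and the edge from
            \<open>x\<close> to the root meet \<open>{x, y}\<close>, so at most two colours are
            lost.\<close>
          have "?X \<subseteq> {{u, v}, {x, w}}" using xy \<open>y \<noteq> w\<close> \<open>y \<notin> {u, v}\<close> \<open>w \<notin> e\<close> uv(1) by auto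
          then have "card ?X \<le> card {{u, v}, {x, w}}" by (intro card_mono) auto
          also have "\<dots> \<le> 2" by (simp add: card_insert_if)
          finally have "card (g ` ?X) \<le> 2" using card_image_le[of ?X g] by simp
          moreover have "card (L e) - card (g ` ?X) \<le> card (L e - g ` ?X)"
            by (rule diff_card_le_card_Diff) simp
          moreover have "k \<le> card (L e)" "finite (L e)" using Lk e \<open>w \<notin> e\<close> by blast+
          ultimately show ?thesis using \<open>w \<notin> e\<close> by simp
        qed
        ultimately show ?thesis
          using finE by (intro bipartite_list_colorable_rooted[where k = "k - 2" and w = w]) blast+
      qed
      ultimately show ?thesis by (rule list_colorable_extend)
    next
      case False
      then have "k = 3" "E - ?F \<noteq> {}" using \<open>k \<ge> 3\<close> by auto
      then obtain y where y: "y \<in> Y" "y \<noteq> w" unfolding E by blast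
      have "z = w \<or> z = y" if "z \<in> Y" for z
      proof (rule ccontr)
        assume z: "\<not> (z = w \<or> z = y)"
        let ?X = "{{u, v}, {u, w}, {u, y}, {u, z}}"
        have "card ?X = 4" using y True that z uv by (auto simp: card_insert_if doubleton_eq_iff)
        moreover have "?X \<subseteq> {e \<in> E. u \<in> e}" using y True that unfolding E by auto
        then have "card ?X \<le> deg E u" unfolding deg_def using finE by (intro card_mono) auto
        ultimately show False using deg \<open>k = 3\<close> by (metis Suc_n_not_le_n eval_nat_numeral(2,3) le_trans semiring_norm(26,27))
      qed
      then have Y: "Y = {w, y}" using y True by blast
      have E5: "E = {{u, w}, {v, w}, {v, y}, {u, y}, {u, v}}" unfolding E Y by auto
      have yuv: "y \<noteq> u" "y \<noteq> v" using y uv by blast+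
      have "card (L {v, y}) \<ge> 3" "card (L {u, y}) \<ge> 3"
        using Lk(2)[of "{v, y}"] Lk(2)[of "{u, y}"] E5 wuv y(2) \<open>k = 3\<close> by auto
      from wheel_choosable[OF Lw this Luv] obtain a b c d h where col:
        "a \<in> L {u, w}" "b \<in> L {v, w}" "c \<in> L {v, y}" "d \<in> L {u, y}" "h \<in> L {u, v}"
        "a \<noteq> b" "b \<noteq> c" "c \<noteq> d" "d \<noteq> a" "h \<notin> {a, b, c, d}" by blast
      define g where "g e = (if e = {u, w} then a else if e = {v, w} then b else if e = {v, y} then c
        else if e = {u, y} then d else h)" for e
      have g: "g {u, w} = a" "g {v, w} = b" "g {v, y} = c" "g {u, y} = d" "g {u, v} = h"
        using uv(1) wuv yuv y(2) by (auto simp: g_def doubleton_eq_iff)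
      have disj: "{u, w} \<inter> {v, y} = {}" "{v, y} \<inter> {u, w} = {}" "{v, w} \<inter> {u, y} = {}" "{u, y} \<inter> {v, w} = {}"
        using uv(1) wuv yuv y(2) by auto
      have "proper_edge_coloring E g"
        unfolding proper_edge_coloring_def E5
        using col(6-10) disj by (simp add: g) blast
      moreover have "\<forall>e\<in>E. g e \<in> L e" using col(1-5) by (simp add: E5 g)
      ultimately show ?thesis unfolding list_colorable_def by blast
    qed
  qed
qed

section \<open>Induction over cut vertices and light edges\<close>

lemma bipartition_mono: "bipartition f E \<Longrightarrow> F \<subseteq> E \<Longrightarrow> bipartition f F"
  unfolding bipartition_def by blast

text \<open>The side \<open>E1\<close> is coloured first. An edge of \<open>E2\<close> at
  \<open>x\<close> starts with at least \<open>deg E x\<close> colours and loses at most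
  \<open>deg E1 x\<close>, which leaves \<open>deg E2 x\<close>; other edges of \<open>E2\<close>
  meet nothing in \<open>E1\<close>. The condition on \<open>w\<close> ensures that the latter have
  full lists.\<close>

lemma list_colorable_separation:
  assumes "graph E" "\<forall>v. deg E v \<le> k" "rooted_lists E k w L"
    and sep: "E1 \<union> E2 = E" "E1 \<inter> E2 = {}" "\<Union>E1 \<inter> \<Union>E2 \<subseteq> {x}" "w \<in> \<Union>E2 \<Longrightarrow> w = x"
    and part: "\<And>L. rooted_lists E1 k w L \<Longrightarrow> list_colorable E1 L" "\<And>L. rooted_lists E2 k x L \<Longrightarrow> list_colorable E2 L"
  shows "list_colorable E L"
proof -
  have finE: "finite E" using assms(1) by (simp add: graph_def)
  have E1: "E1 \<subseteq> E" "E - E1 = E2" using sep(1,2) by blast+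
  have "rooted_lists E1 k w L"
    unfolding rooted_lists_def
  proof
    fix e assume "e \<in> E1"
    then have "e \<in> E" using E1 by blast
    from rooted_listsD[OF assms(3) this] deg_mono[OF finE E1(1), of w]
    show "finite (L e) \<and> (if w \<in> e then deg E1 w else k) \<le> card (L e)" by auto
  qed
  then obtain g where g: "proper_edge_coloring E1 g" "\<forall>e\<in>E1. g e \<in> L e"
    using part(1) unfolding list_colorable_def by blast
  have "rooted_lists E2 k x (\<lambda>e. L e - g ` {e' \<in> E1. e' \<inter> e \<noteq> {}})"
    unfolding rooted_lists_def
  proof
    fix e assume e: "e \<in> E2"
    then have "e \<in> E" using sep(1) by blast
    note old = rooted_listsD[OF assms(3) this]
    let ?X = "{e' \<in> E1. e' \<inter> e \<noteq> {}}"
    have meet: "x \<in> e' \<and> x \<in> e" if "e' \<in> ?X" for e' using that e sep(3) by blast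
    have "deg E2 x \<le> card (L e - g ` ?X)" if "x \<in> e"
    proof -
      have "deg E x \<le> card (L e)"
      proof (cases "w \<in> e")
        case True
        then have "w = x" using e sep(4) by blast
        then show ?thesis using old(2)[OF True] by simp
      next
        case False
        then show ?thesis using old(3) assms(2) le_trans by blast
      qed
      moreover have "deg E x = deg E1 x + deg E2 x" using deg_Diff[OF finE E1(1)] E1(2) by simp
      moreover have "card (g ` ?X) \<le> deg E1 x"
      proof -
        have fin: "finite E1" using finE E1(1) finite_subset by blast
        have "card (g ` ?X) \<le> card ?X" using fin by (intro card_image_le) simp
        also have "\<dots> \<le> deg E1 x" unfolding deg_def using fin meet by (intro card_mono) auto
        finally show ?thesis .
      qed
      moreover have "card (L e) - card (g ` ?X) \<le> card (L e - g ` ?X)"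
        using finE E1(1) finite_subset by (intro diff_card_le_card_Diff) fastforce
      ultimately show ?thesis by linarith
    qed
    moreover have "k \<le> card (L e - g ` ?X)" if "x \<notin> e"
    proof -
      have "L e - g ` ?X = L e" using meet that by blast
      moreover have "w \<notin> e" using e sep(4) that by blast
      ultimately show ?thesis using old(3) by metis
    qed
    ultimately show "finite (L e - g ` ?X) \<and> (if x \<in> e then deg E2 x else k) \<le> card (L e - g ` ?X)"
      using old(1) by simp
  qed
  then show ?thesis using list_colorable_extend[OF g] part(2) E1(2) by simp
qed

text \<open>Both degrees count the edge itself, so a sum of at most 4 leaves at most two
  neighbouring edges.\<close>

lemma list_colorable_light_edge:
  assumes "graph E" "{a, b} \<in> E" "deg E a + deg E b < 5" "card (L {a, b}) \<ge> 3"
    "list_colorable (E - {{a, b}}) L"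
  shows "list_colorable E L"
proof -
  let ?e = "{a, b}" and ?F = "E - {{a, b}}"
  have finE: "finite E" using assms(1) by (simp add: graph_def)
  obtain g where g: "proper_edge_coloring ?F g" "\<forall>e\<in>?F. g e \<in> L e"
    using assms(5) unfolding list_colorable_def by blast
  let ?X = "{e' \<in> ?F. e' \<inter> ?e \<noteq> {}}"
  have "?X \<subseteq> {e \<in> ?F. a \<in> e} \<union> {e \<in> ?F. b \<in> e}" by blast
  then have "card ?X \<le> card ({e \<in> ?F. a \<in> e} \<union> {e \<in> ?F. b \<in> e})" using finE by (intro card_mono) auto
  also have "\<dots> \<le> deg ?F a + deg ?F b" unfolding deg_def by (rule card_Un_le)
  finally have "card ?X \<le> deg ?F a + deg ?F b" .
  moreover have "deg E a = Suc (deg ?F a)" "deg E b = Suc (deg ?F b)"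
    using deg_Diff[OF finE, of "{?e}"] assms(2) deg_singleton[of _ ?e] by auto
  moreover have "card (g ` ?X) \<le> card ?X" using finE by (intro card_image_le) auto
  ultimately have "card (g ` ?X) < card (L ?e)" using assms(3,4) by linarith
  then obtain c where c: "c \<in> L ?e" "c \<notin> g ` ?X" using ex_fresh[of "g ` ?X" "L ?e"] finE by auto
  have "E - ?F = {?e}" using assms(2) by blast
  moreover have "proper_edge_coloring {?e} (\<lambda>_. c)" by (simp add: proper_edge_coloring_def)
  then have "list_colorable {?e} (\<lambda>e. L e - g ` {e' \<in> ?F. e' \<inter> e \<noteq> {}})"
    unfolding list_colorable_def using c by (intro exI[of _ "\<lambda>_. c"]) auto
  ultimately show ?thesis using list_colorable_extend[OF g, of E] by simp
qed

lemma list_colorable_rooted: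
  assumes "graph E" "odd_cycles_share_at_most_one E" "\<forall>v. deg E v \<le> k"
    "(\<exists>f. bipartition f E) \<or> k \<ge> 3" "rooted_lists E k w L"
  shows "list_colorable E L"
  using assms
proof (induction "card E" arbitrary: E w L rule: less_induct)
  case less
  note gr = less.prems(1) and share = less.prems(2) and deg = less.prems(3) and L = less.prems(5)
  have finE: "finite E" using gr by (simp add: graph_def)
  have IH: "list_colorable F L'" if "F \<subset> E" "rooted_lists F k w' L'" for F w' L'
  proof (rule less.hyps)
    show "card F < card E" using that(1) finE by (rule psubset_card_mono[rotated])
    show "graph F" using graph_subset[OF gr] that(1) by blast
    show "odd_cycles_share_at_most_one F" using odd_cycles_share_at_most_one_mono[OF share] that(1) by blast
    show "\<forall>v. deg F v \<le> k" using deg_mono[OF finE, of F] that(1) deg by (meson le_trans psubset_imp_subset)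
    show "(\<exists>f. bipartition f F) \<or> k \<ge> 3" using less.prems(4) bipartition_mono that(1) by blast
    show "rooted_lists F k w' L'" by (rule that(2))
  qed
  show ?case
  proof (cases "inseparable E")
    case False
    then obtain E1 E2 x where sep: "E1 \<union> E2 = E" "E1 \<inter> E2 = {}" "\<Union>E1 \<inter> \<Union>E2 \<subseteq> {x}" "E1 \<noteq> {}" "E2 \<noteq> {}"
      unfolding inseparable_def by blast
    then have sub: "E1 \<subset> E" "E2 \<subset> E" by blast+
    have sep': "E2 \<union> E1 = E" "E2 \<inter> E1 = {}" "\<Union>E2 \<inter> \<Union>E1 \<subseteq> {x}" using sep by blast+
    show ?thesis
    \<comment> \<open>The side containing the root goes first and the other one is rooted at
      \<open>x\<close>; unless \<open>w = x\<close>, the root lies on at most one side.\<close>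
    proof (cases "w \<in> \<Union>E2 \<longrightarrow> w = x")
      case True
      then show ?thesis
        using list_colorable_separation[OF gr deg L sep(1-3)] IH[OF sub(1)] IH[OF sub(2)] by blast
    next
      case False
      then have "w \<notin> \<Union>E1" using sep(3) by blast
      then show ?thesis
        using list_colorable_separation[OF gr deg L sep'] IH[OF sub(1)] IH[OF sub(2)] by blast
    qed
  next
    case insep: True
    show ?thesis
    proof (cases "\<exists>f. bipartition f E")
      case True
      then show ?thesis
        using bipartite_list_colorable_rooted[OF finE _ deg] L unfolding rooted_lists_def by blast
    next
      case False
      then have "k \<ge> 3" using less.prems(4) by blast
      show ?thesis
      proof (cases "\<exists>a b. {a, b} \<in> E \<and> w \<notin> {a, b} \<and> deg E a + deg E b < 5")
        case True
        then obtain a b where ab: "{a, b} \<in> E" "w \<notin> {a, b}" "deg E a + deg E b < 5" by blast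
        have "rooted_lists (E - {{a, b}}) k w L"
          unfolding rooted_lists_def
        proof
          fix e assume "e \<in> E - {{a, b}}"
          then have "e \<in> E" by blast
          from rooted_listsD[OF L this] deg_mono[OF finE, of "E - {{a, b}}" w]
          show "finite (L e) \<and> (if w \<in> e then deg (E - {{a, b}}) w else k) \<le> card (L e)" by auto
        qed
        then have "list_colorable (E - {{a, b}}) L" using IH[of "E - {{a, b}}" w L] ab(1) by blast
        moreover have "card (L {a, b}) \<ge> 3" using rooted_listsD(3)[OF L ab(1,2)] \<open>k \<ge> 3\<close> by simp
        ultimately show ?thesis using list_colorable_light_edge[OF gr ab(1,3)] by blast
      next
        case no_light: False
        have heavy: "\<forall>a b. {a, b} \<in> E \<longrightarrow> w \<notin> {a, b} \<longrightarrow> deg E a + deg E b \<ge> 5"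
          using no_light by (meson not_le)
        obtain vs where vs: "is_cycle_list E vs" "odd (length vs)"
          using bipartition_if_no_odd_cycle[OF gr] False by blast
        show ?thesis
        proof (cases "\<exists>us. is_cycle_list E us \<and> odd (length us) \<and> length us \<ge> 5")
          case True
          then obtain us where "is_cycle_list E us" "odd (length us)" "length us \<ge> 5" by blast
          from structure_long_odd_cycle[OF gr share insep this heavy] obtain u v f where
            "{u, v} \<in> E" "bipartition f (E - {{u, v}})" "\<forall>z. z \<notin> {u, v} \<longrightarrow> deg E z \<le> 2"
            "\<not> ({u, w} \<in> E \<and> {v, w} \<in> E)" by blast
          then show ?thesis using list_colorable_near_bipartite[OF gr _ _ deg _ \<open>k \<ge> 3\<close> _ L] by blast
        next
          case False
          then have "\<forall>us. is_cycle_list E us \<longrightarrow> odd (length us) \<longrightarrow> length us < 5"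
            by (meson not_le)
          from structure_triangles[OF gr share insep vs this] show ?thesis
          proof (elim disjE exE conjE)
            fix u v Y
            assume "u \<noteq> v" "u \<notin> Y" "v \<notin> Y" "E = {{u, v}} \<union> (\<lambda>y. {u, y}) ` Y \<union> (\<lambda>y. {v, y}) ` Y"
            then show ?thesis by (rule list_colorable_K11p[OF gr _ _ _ _ deg \<open>k \<ge> 3\<close> L])
          next
            fix a b c d
            assume K4: "distinct [a, b, c, d]" "E = {{a, b}, {a, c}, {a, d}, {b, c}, {b, d}, {c, d}}"
            \<comment> \<open>In \<open>K\<^sub>4\<close> the root itself has degree at least 3, so
              even the lists at the root have three colours.\<close>
            have deg3: "deg E w \<ge> 3" if "w \<in> {a, b, c, d}"
            proof -
              define X where "X = {{w, z} | z. z \<in> {a, b, c, d} \<and> z \<noteq> w}"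
              have "X = (\<lambda>z. {w, z}) ` ({a, b, c, d} - {w})" unfolding X_def by blast
              moreover have "inj_on (\<lambda>z. {w, z}) ({a, b, c, d} - {w})"
                by (auto simp: inj_on_def doubleton_eq_iff)
              moreover have "card ({a, b, c, d} - {w}) = 3" using that K4(1) by simp
              ultimately have "card X = 3" by (simp only: card_image)
              moreover have "X \<subseteq> {e \<in> E. w \<in> e}" unfolding X_def K4(2) using that by auto
              then have "card X \<le> deg E w" unfolding deg_def using finE by (intro card_mono) auto
              ultimately show ?thesis by simp
            qed
            have "card (L e) \<ge> 3" if "e \<in> E" for e
            proof (cases "w \<in> e")
              case True
              then have "w \<in> {a, b, c, d}" using that unfolding K4(2) by auto
              then show ?thesis using deg3 rooted_listsD(2)[OF L that True] by simp
            next
              case False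
              then show ?thesis using rooted_listsD(3)[OF L that] \<open>k \<ge> 3\<close> by simp
            qed
            then show ?thesis using list_colorable_K4[OF K4] by blast
          qed
        qed
      qed
    qed
  qed
qed

text \<open>Consecutive edges are distinct because the cycle has at least three, so the two colours
  alternate; returning to \<open>e 0\<close> after \<open>n\<close> steps makes \<open>n\<close>
  even.\<close>

lemma two_coloring_cycle_even:
  assumes "is_cycle_list E vs" "proper_edge_coloring E f" "\<forall>e\<in>E. f e < (2::nat)"
  shows "even (length vs)"
proof -
  define n where "n = length vs"
  have n: "n \<ge> 3" "distinct vs" using assms(1) by (auto simp: is_cycle_list_iff n_def)
  define e where "e i = {vs ! (i mod n), vs ! (Suc i mod n)}" for i
  have inE: "e i \<in> E" for i
  proof -
    have "i mod n < n" using n by simp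
    then have "{vs ! (i mod n), vs ! ((i mod n + 1) mod n)} \<in> E"
      using assms(1) unfolding is_cycle_list_def n_def by blast
    then show ?thesis by (simp add: e_def mod_Suc_eq)
  qed
  have "f (e (Suc i)) \<noteq> f (e i)" for i
  proof -
    have "i mod n \<noteq> Suc i mod n" "Suc i mod n \<noteq> Suc (Suc i) mod n" "i mod n \<noteq> Suc (Suc i) mod n"
      using n(1) by (auto simp: mod_Suc)
    moreover have "p mod n < length vs" for p
      unfolding n_def[symmetric] using n(1) by (intro mod_less_divisor) simp
    then have "vs ! (p mod n) = vs ! (q mod n) \<longleftrightarrow> p mod n = q mod n" for p q
      using nth_eq_iff_index_eq[OF n(2)] by blast
    ultimately have "e (Suc i) \<noteq> e i" unfolding e_def doubleton_eq_iff by metis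
    then show ?thesis
      using proper_edge_coloringD[OF assms(2) inE[of "Suc i"] inE[of i], of "vs ! (Suc i mod n)"]
      by (auto simp: e_def)
  qed
  moreover have "f (e i) < 2" for i using assms(3) inE by blast
  ultimately have step: "f (e (Suc i)) = 1 - f (e i)" for i
    by (metis One_nat_def Suc_1 diff_Suc_1 diff_zero less_2_cases)
  have "f (e i) = (if even i then f (e 0) else 1 - f (e 0))" for i
  proof (induction i)
    case (Suc i)
    have "f (e 0) < 2" using assms(3) inE by blast
    then show ?case using Suc step[of i] by auto
  qed simp
  from this[of n] have "f (e n) = (if even n then f (e 0) else 1 - f (e 0))" .
  moreover have "e n = e 0" by (simp add: e_def mod_Suc)
  moreover have "f (e 0) < 2" using assms(3) inE by blast
  ultimately have "even n" by (metis One_nat_def diff_self_eq_0 diff_zero less_2_cases n_not_Suc_n)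
  then show ?thesis by (simp add: n_def)
qed

theorem mainTheorem2:
  fixes V :: "'a set" and E :: "'a set set"
  assumes "in_G_star V E"
  shows "list_chromatic_index E = chromatic_index E"
proof -
  have "E \<subseteq> Pow V" "finite V" "\<forall>e\<in>E. card e = 2" and share: "odd_cycles_share_at_most_one E"
    using assms by (auto simp: in_G_star_def simple_graph_def odd_cycles_share_at_most_one_def)
  then have finE: "finite E" and gr: "graph E" by (auto simp: graph_def intro: finite_subset)
  define colorable where "colorable k \<longleftrightarrow> (\<exists>f :: 'a set \<Rightarrow> nat.
    proper_edge_coloring E f \<and> (\<forall>e\<in>E. f e < k))" for k
  define choosable where "choosable k \<longleftrightarrow> (\<forall>L :: 'a set \<Rightarrow> nat set.
      (\<forall>e\<in>E. finite (L e) \<and> card (L e) \<ge> k) \<longrightarrow>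
      (\<exists>f. proper_edge_coloring E f \<and> (\<forall>e\<in>E. f e \<in> L e)))" for k
  define k where "k = chromatic_index E"
  have "\<exists>k. colorable k"
  proof -
    obtain f :: "'a set \<Rightarrow> nat" where f: "inj_on f E"
      using finite_imp_inj_to_nat_seg[OF finE] by blast
    then have "proper_edge_coloring E f" by (auto simp: proper_edge_coloring_def inj_on_def)
    moreover have "\<forall>e\<in>E. f e < Suc (Max (f ` E))" using finE by (simp add: less_Suc_eq_le)
    ultimately show ?thesis unfolding colorable_def by blast
  qed
  then have "colorable k"
    unfolding k_def chromatic_index_def colorable_def by (rule LeastI_ex)
  then obtain f :: "'a set \<Rightarrow> nat" where f: "proper_edge_coloring E f" "\<forall>e\<in>E. f e < k"
    unfolding colorable_def by blast
  have deg: "\<forall>v. deg E v \<le> k"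
  proof
    fix v
    have "card (f ` {e \<in> E. v \<in> e}) \<le> card {..<k}" using f(2) by (intro card_mono) auto
    then show "deg E v \<le> k"
      using card_image[OF proper_edge_coloring_inj_on[OF f(1), of v]] by (simp add: deg_def)
  qed
  have bip: "(\<exists>f. bipartition f E) \<or> k \<ge> 3"
  proof (cases "k \<ge> 3")
    case False
    then have "\<forall>e\<in>E. f e < 2" using f(2) by fastforce
    then show ?thesis using bipartition_if_no_odd_cycle[OF gr] two_coloring_cycle_even[OF _ f(1)] by blast
  qed simp
  have "choosable k"
    unfolding choosable_def
  proof (intro allI impI)
    fix L :: "'a set \<Rightarrow> nat set" assume L: "\<forall>e\<in>E. finite (L e) \<and> card (L e) \<ge> k"
    \<comment> \<open>Any vertex can act as the root here: every degree is at most \<open>k\<close>,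
      so lists of size \<open>k\<close> are long enough everywhere.\<close>
    have "rooted_lists E k undefined L"
      unfolding rooted_lists_def using L deg by (auto intro: le_trans)
    from list_colorable_rooted[OF gr share deg bip this]
    show "\<exists>f. proper_edge_coloring E f \<and> (\<forall>e\<in>E. f e \<in> L e)" by (simp add: list_colorable_def)
  qed
  moreover have "k \<le> j" if "choosable j" for j
  proof -
    \<comment> \<open>Choosing from the constant list \<open>{..<j}\<close> is ordinary colouring
      with \<open>j\<close> colours, which gives the lower bound.\<close>
    have "\<exists>f. proper_edge_coloring E f \<and> (\<forall>e\<in>E. f e \<in> {..<j})"
      using that unfolding choosable_def by (elim allE[of _ "\<lambda>_. {..<j}"]) simp
    then have "colorable j" by (simp add: colorable_def)
    then show ?thesis unfolding k_def chromatic_index_def colorable_def by (rule Least_le)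
  qed
  ultimately have "(LEAST j. choosable j) = k" by (rule Least_equality)
  then show ?thesis by (simp add: list_chromatic_index_def choosable_def k_def)
qed

end
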